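(* Presburger Arithmetic $\mathrm{PrA}$ is not one-dimensionally interpretable in any of its finitely axiomatizable subtheories; that is, there is no finitely axiomatizable theory $\mathrm{T}$ in the signature $\{=,+\}$ with $\mathrm{PrA}\vdash\mathrm{T}$ such that some one-dimensional translation is an interpretation of $\mathrm{PrA}$ in $\mathrm{T}$.
   Context: $\mathrm{PrA}$ is the complete first-order theory of $(\mathbb{N},+)$. A one-dimensional translation $\iota$ from $\{=,+\}$ to $\{=,+\}$ consists of formulas $\mathit{Dom}_\iota(y)$, $\mathit{Pred}_{\iota,=}(y_1,y_2)$, $\mathit{Fun}_{\iota,+}(y_0,y_1,y_2)$ in single variables. It is an interpretation of a structure $\mathfrak{A}$ in a structure $\mathfrak{B}$ if $\mathit{Dom}_\iota$ defines a nonempty $D\subseteq B$, $\mathit{Pred}_{\iota,=}$ defines an equivalence $\sim$ on $D$, and there is a bijection $h:D/{\sim}\to A$ with $\mathfrak{A}\models h([b_0])=h([b_1])+h([b_2])$ iff $\mathfrak{B}\models\mathit{Fun}_{\iota,+}(b_0,b_1,b_2)$. It is an interpretation of a theory $\mathbf{S}$ in a structure $\mathfrak{B}$ if it interprets some model of $\mathbf{S}$ in $\mathfrak{B}$, and an interpretation of $\mathbf{S}$ in a theory $\mathbf{U}$ if it is an interpretation of $\mathbf{S}$ in every model of $\mathbf{U}$. *)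

theory Defs
  imports Main
begin

section \<open>First-order syntax over the signature of addition and equality\<close>

text \<open>Variables are de Bruijn indices: \<open>All\<close> binds index 0.  The remaining connectives are
  definable from falsity, implication and the universal quantifier.\<close>

datatype tm = Var nat | Add tm tm

datatype fm = Falsum | Eq tm tm | Imp fm fm | All fm

primrec fv_tm :: "tm \<Rightarrow> nat set" where
  "fv_tm (Var n) = {n}"
| "fv_tm (Add s t) = fv_tm s \<union> fv_tm t"

primrec fv :: "fm \<Rightarrow> nat set" where
  "fv Falsum = {}"
| "fv (Eq s t) = fv_tm s \<union> fv_tm t"
| "fv (Imp \<phi> \<psi>) = fv \<phi> \<union> fv \<psi>"
| "fv (All \<phi>) = {n. Suc n \<in> fv \<phi>}"

definition sentence :: "fm \<Rightarrow> bool" where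
  "sentence \<phi> \<longleftrightarrow> fv \<phi> = {}"

abbreviation scons :: "'a \<Rightarrow> (nat \<Rightarrow> 'a) \<Rightarrow> nat \<Rightarrow> 'a"  (infixr "##" 65) where
  "a ## e \<equiv> case_nat a e"

primrec subst_tm :: "(nat \<Rightarrow> tm) \<Rightarrow> tm \<Rightarrow> tm" where
  "subst_tm \<sigma> (Var n) = \<sigma> n"
| "subst_tm \<sigma> (Add s t) = Add (subst_tm \<sigma> s) (subst_tm \<sigma> t)"

primrec subst :: "(nat \<Rightarrow> tm) \<Rightarrow> fm \<Rightarrow> fm" where
  "subst \<sigma> Falsum = Falsum"
| "subst \<sigma> (Eq s t) = Eq (subst_tm \<sigma> s) (subst_tm \<sigma> t)"
| "subst \<sigma> (Imp \<phi> \<psi>) = Imp (subst \<sigma> \<phi>) (subst \<sigma> \<psi>)"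
| "subst \<sigma> (All \<phi>) = All (subst (Var 0 ## (\<lambda>n. subst_tm (\<lambda>k. Var (Suc k)) (\<sigma> n))) \<phi>)"

abbreviation shift :: "fm \<Rightarrow> fm" where
  "shift \<equiv> subst (\<lambda>k. Var (Suc k))"

abbreviation inst :: "tm \<Rightarrow> fm \<Rightarrow> fm" where
  "inst t \<equiv> subst (t ## Var)"

section \<open>Provability: classical natural deduction with equality\<close>

text \<open>In \<open>allI\<close>, shifting the hypotheses makes index 0 the eigenvariable.\<close>

inductive proves :: "fm set \<Rightarrow> fm \<Rightarrow> bool"  (infix "\<turnstile>" 50) where
  hyp: "\<phi> \<in> \<Gamma> \<Longrightarrow> \<Gamma> \<turnstile> \<phi>"
| impI: "insert \<phi> \<Gamma> \<turnstile> \<psi> \<Longrightarrow> \<Gamma> \<turnstile> Imp \<phi> \<psi>"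
| impE: "\<Gamma> \<turnstile> Imp \<phi> \<psi> \<Longrightarrow> \<Gamma> \<turnstile> \<phi> \<Longrightarrow> \<Gamma> \<turnstile> \<psi>"
| raa: "insert (Imp \<phi> Falsum) \<Gamma> \<turnstile> Falsum \<Longrightarrow> \<Gamma> \<turnstile> \<phi>"
| allI: "shift ` \<Gamma> \<turnstile> \<phi> \<Longrightarrow> \<Gamma> \<turnstile> All \<phi>"
| allE: "\<Gamma> \<turnstile> All \<phi> \<Longrightarrow> \<Gamma> \<turnstile> inst t \<phi>"
| eq_refl: "\<Gamma> \<turnstile> Eq t t"
| eq_subst: "\<Gamma> \<turnstile> Eq s t \<Longrightarrow> \<Gamma> \<turnstile> inst s \<phi> \<Longrightarrow> \<Gamma> \<turnstile> inst t \<phi>"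

definition is_theory :: "fm set \<Rightarrow> bool" where
  "is_theory T \<longleftrightarrow> (\<forall>\<phi>\<in>T. sentence \<phi>)"

definition proves_theory :: "fm set \<Rightarrow> fm set \<Rightarrow> bool" where
  "proves_theory S T \<longleftrightarrow> (\<forall>\<phi>\<in>T. S \<turnstile> \<phi>)"

text \<open>A theory need not be deductively closed, so an axiomatization only has to have the same
  consequences.\<close>

definition finitely_axiomatizable :: "fm set \<Rightarrow> bool" where
  "finitely_axiomatizable T \<longleftrightarrow>
    (\<exists>F. finite F \<and> is_theory F \<and> (\<forall>\<phi>. sentence \<phi> \<longrightarrow> (F \<turnstile> \<phi> \<longleftrightarrow> T \<turnstile> \<phi>)))"

section \<open>Structures and models\<close>

record 'a struct =
  carrier :: "'a set"
  add :: "'a \<Rightarrow> 'a \<Rightarrow> 'a"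

definition is_struct :: "'a struct \<Rightarrow> bool" where
  "is_struct M \<longleftrightarrow>
    carrier M \<noteq> {} \<and> (\<forall>a\<in>carrier M. \<forall>b\<in>carrier M. add M a b \<in> carrier M)"

primrec eval :: "'a struct \<Rightarrow> (nat \<Rightarrow> 'a) \<Rightarrow> tm \<Rightarrow> 'a" where
  "eval M e (Var n) = e n"
| "eval M e (Add s t) = add M (eval M e s) (eval M e t)"

primrec sat :: "'a struct \<Rightarrow> (nat \<Rightarrow> 'a) \<Rightarrow> fm \<Rightarrow> bool" where
  "sat M e Falsum \<longleftrightarrow> False"
| "sat M e (Eq s t) \<longleftrightarrow> eval M e s = eval M e t"
| "sat M e (Imp \<phi> \<psi>) \<longleftrightarrow> (sat M e \<phi> \<longrightarrow> sat M e \<psi>)"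
| "sat M e (All \<phi>) \<longleftrightarrow> (\<forall>a\<in>carrier M. sat M (a ## e) \<phi>)"

definition is_model :: "'a struct \<Rightarrow> fm set \<Rightarrow> bool" where
  "is_model M T \<longleftrightarrow>
    is_struct M \<and> (\<forall>\<phi>\<in>T. \<forall>e. range e \<subseteq> carrier M \<longrightarrow> sat M e \<phi>)"

definition nat_struct :: "nat struct" where
  "nat_struct = \<lparr>carrier = UNIV, add = (+)\<rparr>"

definition PrA :: "fm set" where
  "PrA = {\<phi>. sentence \<phi> \<and> (\<forall>e. sat nat_struct e \<phi>)}"

section \<open>One-dimensional interpretations\<close>

text \<open>The arguments of the three formulas are the indices 0; 0, 1; and 0, 1, 2.  In
  \<open>Add_fm\<close>, index 0 is the value and indices 1, 2 are the summands.\<close>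

record translation =
  Dom_fm :: fm
  Eq_fm :: fm
  Add_fm :: fm

definition is_translation :: "translation \<Rightarrow> bool" where
  "is_translation \<iota> \<longleftrightarrow>
    fv (Dom_fm \<iota>) \<subseteq> {0} \<and> fv (Eq_fm \<iota>) \<subseteq> {0, 1} \<and> fv (Add_fm \<iota>) \<subseteq> {0, 1, 2}"

text \<open>Below, the constant tail of an environment only fills the indices that do not occur free.\<close>

definition int_dom :: "translation \<Rightarrow> 'a struct \<Rightarrow> 'a set" where
  "int_dom \<iota> B = {b \<in> carrier B. sat B (\<lambda>_. b) (Dom_fm \<iota>)}"

definition int_rel :: "translation \<Rightarrow> 'a struct \<Rightarrow> ('a \<times> 'a) set" where
  "int_rel \<iota> B =
    {(b1, b2). b1 \<in> int_dom \<iota> B \<and> b2 \<in> int_dom \<iota> B \<and> sat B (b1 ## (\<lambda>_. b2)) (Eq_fm \<iota>)}"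

definition interprets_struct :: "translation \<Rightarrow> 'b struct \<Rightarrow> 'a struct \<Rightarrow> bool" where
  "interprets_struct \<iota> A B \<longleftrightarrow>
    int_dom \<iota> B \<noteq> {} \<and>
    equiv (int_dom \<iota> B) (int_rel \<iota> B) \<and>
    (\<exists>h. bij_betw h (int_dom \<iota> B // int_rel \<iota> B) (carrier A) \<and>
      (\<forall>b0\<in>int_dom \<iota> B. \<forall>b1\<in>int_dom \<iota> B. \<forall>b2\<in>int_dom \<iota> B.
        h (int_rel \<iota> B `` {b0}) = add A (h (int_rel \<iota> B `` {b1})) (h (int_rel \<iota> B `` {b2}))
        \<longleftrightarrow> sat B (b0 ## b1 ## (\<lambda>_. b2)) (Add_fm \<iota>)))"

text \<open>An interpreted model is in bijection with a set of equivalence classes, hence isomorphic to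
  one whose carrier consists of sets of elements of \<open>B\<close>; so taking \<open>A\<close> over the type
  \<open>'a set\<close> loses nothing.\<close>

definition interprets_in_struct :: "translation \<Rightarrow> fm set \<Rightarrow> 'a struct \<Rightarrow> bool" where
  "interprets_in_struct \<iota> S B \<longleftrightarrow>
    (\<exists>A :: 'a set struct. is_model A S \<and> interprets_struct \<iota> A B)"

text \<open>HOL cannot quantify over the types of carriers, so the type argument fixes the type from which
  the carriers of the models of \<open>U\<close> are taken (as arbitrary subsets).  For an infinite type
  this covers all countable models up to isomorphism.  The condition is implied by the one ranging
  over models of every type, so refuting it for each infinite type refutes the latter as well.\<close>

definition interprets_in_theory ::
    "'a itself \<Rightarrow> translation \<Rightarrow> fm set \<Rightarrow> fm set \<Rightarrow> bool" where
  "interprets_in_theory (_ :: 'a itself) \<iota> S U \<longleftrightarrow>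
    (\<forall>B :: 'a struct. is_model B U \<longrightarrow> interprets_in_struct \<iota> S B)"

end

theory Submission
  imports Defs "HOL-Computational_Algebra.Polynomial" "HOL-Computational_Algebra.Primes"
    "HOL-Library.FuncSet" "HOL-Library.Countable"
begin

text \<open>A back-and-forth argument shows that a formula cannot distinguish tuples whose integer linear
  forms with bounded coefficients have the same signs and whose entries have the same residues modulo
  some \<open>M\<close>, uniformly in all discretely ordered groups with division by every number not divisible
  by a large prime \<open>p\<close>.

  In \<open>\<nat>\<close> this makes definable sets eventually periodic, with a period independent of the parameters.
  Hence the interpreted structure is standard: otherwise the cuts below \<open>0, a, 2 a, \<dots>\<close> for a
  nonstandard \<open>a\<close> would eventually contain ever more residue classes.  Moreover the rank \<open>\<rho> d\<close> of
  an element in the interpreted order changes by a bounded amount between \<open>d\<close> and \<open>d + M\<close>; since each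
  value of the change is attained on an eventually periodic set, \<open>\<rho>\<close> is linear along some arithmetic
  progression.  So \<open>\<nat>\<close> satisfies a sentence defining an additive map, cofinal up to bounded gaps,
  into the interpreted structure.

  The sentence, and any finite part of \<open>PrA\<close>, also holds for large primes \<open>p\<close> in the nonnegative part
  of the group of linear polynomials \<open>q X + a\<close>, where \<open>a\<close> is an integer, \<open>q\<close> is a rational number
  with denominator prime to \<open>p\<close>, and \<open>X\<close> is infinitely large.  If the interpreted structure were a
  model of \<open>PrA\<close>, the image of \<open>X\<close> could be divided by \<open>p\<close> with remainder, and pulling the quotient
  back would give \<open>X\<close> as a multiple of \<open>p\<close> up to a standard error, which is impossible.\<close>

section \<open>Soundness and isomorphism\<close>

lemma eval_subst_tm: "eval M e (subst_tm \<sigma> t) = eval M (\<lambda>n. eval M e (\<sigma> n)) t"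
  by (induction t) auto

lemma sat_subst: "sat M e (subst \<sigma> \<phi>) \<longleftrightarrow> sat M (\<lambda>n. eval M e (\<sigma> n)) \<phi>"
proof (induction \<phi> arbitrary: \<sigma> e)
  case (All \<phi>)
  have "(\<lambda>n. eval M (a ## e) ((Var 0 ## (\<lambda>n. subst_tm (\<lambda>k. Var (Suc k)) (\<sigma> n))) n))
      = a ## (\<lambda>n. eval M e (\<sigma> n))" for a
    by (rule ext) (simp add: eval_subst_tm split: nat.split)
  then show ?case
    by (simp add: All)
qed (simp_all add: eval_subst_tm)

lemma eval_cong_fv: "(\<And>n. n \<in> fv_tm t \<Longrightarrow> e n = e' n) \<Longrightarrow> eval M e t = eval M e' t"
  by (induction t) auto

lemma sat_cong_fv: "(\<And>n. n \<in> fv \<phi> \<Longrightarrow> e n = e' n) \<Longrightarrow> sat M e \<phi> \<longleftrightarrow> sat M e' \<phi>"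
proof (induction \<phi> arbitrary: e e')
  case (Eq s t)
  then show ?case using eval_cong_fv[of s e e' M] eval_cong_fv[of t e e' M] by simp
next
  case (Imp \<phi> \<psi>)
  then show ?case by (metis UnCI fv.simps(3) sat.simps(3))
next
  case (All \<phi>)
  have "sat M (a ## e) \<phi> \<longleftrightarrow> sat M (a ## e') \<phi>" for a
    by (rule All.IH) (use All.prems in \<open>auto split: nat.split\<close>)
  then show ?case by simp
qed simp

lemma sat_sentence: "sentence \<phi> \<Longrightarrow> sat M e \<phi> \<longleftrightarrow> sat M e' \<phi>"
  by (rule sat_cong_fv) (simp add: sentence_def)

lemma eval_carrier:
  "is_struct M \<Longrightarrow> range e \<subseteq> carrier M \<Longrightarrow> eval M e t \<in> carrier M"
  by (induction t) (auto simp: is_struct_def)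

lemma range_scons: "a \<in> A \<Longrightarrow> range e \<subseteq> A \<Longrightarrow> range (a ## e) \<subseteq> A"
  by (auto simp: image_subset_iff split: nat.split)

lemma soundness:
  assumes "\<Gamma> \<turnstile> \<phi>" "is_struct M" "range e \<subseteq> carrier M" "\<And>\<psi>. \<psi> \<in> \<Gamma> \<Longrightarrow> sat M e \<psi>"
  shows "sat M e \<phi>"
  using assms
proof (induction arbitrary: e rule: proves.induct)
  case (allI \<Gamma> \<phi>)
  have "sat M (a ## e) \<phi>" if "a \<in> carrier M" for a
    by (rule allI.IH) (use allI.prems range_scons[OF that] in \<open>auto simp: sat_subst\<close>)
  then show ?case by simp
next
  case (allE \<Gamma> \<phi> t)
  have "sat M e (All \<phi>)" by (rule allE.IH) (use allE.prems in auto)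
  moreover have "(\<lambda>n. eval M e ((t ## Var) n)) = eval M e t ## e"
    by (rule ext) (simp split: nat.split)
  ultimately show ?case
    using eval_carrier[of M e t] allE.prems by (simp add: sat_subst)
next
  case (eq_subst \<Gamma> s t \<phi>)
  have "(\<lambda>n. eval M e ((r ## Var) n)) = eval M e r ## e" for r
    by (rule ext) (simp split: nat.split)
  moreover have "sat M e (Eq s t)" "sat M e (inst s \<phi>)"
    using eq_subst by blast+
  ultimately show ?case
    by (simp add: sat_subst)
next
  case (impI \<phi> \<Gamma> \<psi>)
  have "sat M e \<psi>" if "sat M e \<phi>"
    by (rule impI.IH) (use impI.prems that in auto)
  then show ?case by simp
next
  case (raa \<phi> \<Gamma>)
  have "sat M e Falsum" if "\<not> sat M e \<phi>"
    by (rule raa.IH) (use raa.prems that in auto)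
  then show ?case by auto
next
  case (impE \<Gamma> \<phi> \<psi>)
  then show ?case by (meson sat.simps(3))
qed simp_all

lemma model_proves:
  assumes "is_model M S" "proves_theory S T"
  shows "is_model M T"
  using assms soundness[of S _ M] unfolding is_model_def proves_theory_def by blast

text \<open>Each theory proves the sentences of the other, so soundness carries models in both
  directions.\<close>

lemma model_axiomatization:
  assumes "is_theory T" "\<And>\<phi>. sentence \<phi> \<Longrightarrow> F \<turnstile> \<phi> \<longleftrightarrow> T \<turnstile> \<phi>" "is_theory F"
  shows "is_model M F \<longleftrightarrow> is_model M T"
proof -
  have "proves_theory F T" "proves_theory T F"
    using assms unfolding proves_theory_def is_theory_def by (meson hyp)+
  then show ?thesis using model_proves by blast
qed

section \<open>Transport along isomorphisms\<close>

definition struct_iso :: "('a \<Rightarrow> 'b) \<Rightarrow> 'a struct \<Rightarrow> 'b struct \<Rightarrow> bool" where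
  "struct_iso j M N \<longleftrightarrow> bij_betw j (carrier M) (carrier N) \<and>
     (\<forall>a\<in>carrier M. \<forall>b\<in>carrier M. j (add M a b) = add N (j a) (j b))"

lemma eval_iso:
  assumes "struct_iso j M N" "is_struct M" "range e \<subseteq> carrier M"
  shows "eval N (\<lambda>n. j (e n)) t = j (eval M e t)"
  using assms eval_carrier[OF assms(2,3)] by (induction t) (auto simp: struct_iso_def)

lemma sat_iso:
  assumes "struct_iso j M N" "is_struct M" "range e \<subseteq> carrier M"
  shows "sat N (\<lambda>n. j (e n)) \<phi> \<longleftrightarrow> sat M e \<phi>"
  using assms(3)
proof (induction \<phi> arbitrary: e)
  case (Eq s t)
  have "inj_on j (carrier M)" using assms(1) by (auto simp: struct_iso_def bij_betw_def)
  then show ?case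
    using eval_iso[OF assms(1,2) Eq] eval_carrier[OF assms(2) Eq] by (auto dest: inj_onD)
next
  case (All \<phi>)
  have N: "carrier N = j ` carrier M" using assms(1) by (auto simp: struct_iso_def bij_betw_def)
  have "sat N (j a ## (\<lambda>n. j (e n))) \<phi> \<longleftrightarrow> sat M (a ## e) \<phi>" if "a \<in> carrier M" for a
  proof -
    have "j a ## (\<lambda>n. j (e n)) = (\<lambda>n. j ((a ## e) n))"
      by (rule ext) (simp split: nat.split)
    then show ?thesis using All.IH[OF range_scons[OF that All.prems]] by simp
  qed
  then show ?case by (simp add: N)
qed simp_all

lemma struct_iso_struct:
  assumes "struct_iso j M N" "is_struct M"
  shows "is_struct N"
proof -
  have N: "carrier N = j ` carrier M"
    and add: "\<And>a b. a \<in> carrier M \<Longrightarrow> b \<in> carrier M \<Longrightarrow> add N (j a) (j b) = j (add M a b)"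
    using assms(1) by (auto simp: struct_iso_def bij_betw_def)
  show ?thesis using assms(2) by (auto simp: is_struct_def N add)
qed

lemma struct_iso_model:
  assumes "struct_iso j M N" "is_model M T"
  shows "is_model N T"
proof -
  have M: "is_struct M" using assms(2) by (simp add: is_model_def)
  have N: "carrier N = j ` carrier M" using assms(1) by (auto simp: struct_iso_def bij_betw_def)
  have "sat N e \<phi>" if "\<phi> \<in> T" "range e \<subseteq> carrier N" for \<phi> e
  proof -
    have "\<forall>n. \<exists>a. a \<in> carrier M \<and> e n = j a" using that(2) N by auto
    then obtain e' where e': "\<And>n. e' n \<in> carrier M \<and> e n = j (e' n)" by metis
    then have "e = (\<lambda>n. j (e' n))" "range e' \<subseteq> carrier M" by auto
    then show ?thesis using sat_iso[OF assms(1) M] assms(2) that(1) by (auto simp: is_model_def)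
  qed
  then show ?thesis using struct_iso_struct[OF assms(1) M] by (simp add: is_model_def)
qed

text \<open>This moves a model living on any type onto the type fixed in
  \<open>interprets_in_theory\<close>, once its carrier embeds there.\<close>

lemma transport_struct:
  fixes M :: "'a struct" and j :: "'a \<Rightarrow> 'b"
  assumes "inj_on j (carrier M)"
  obtains N where "struct_iso j M N"
proof
  show "struct_iso j M \<lparr>carrier = j ` carrier M,
     add = \<lambda>a b. j (add M (inv_into (carrier M) j a) (inv_into (carrier M) j b))\<rparr>"
    using assms by (auto simp: struct_iso_def bij_betw_def)
qed

text \<open>The quotient by the interpreted equality disappears in the surjection \<open>H\<close>, which need not
  be injective.\<close>

definition interp_map :: "translation \<Rightarrow> 'b struct \<Rightarrow> 'c struct \<Rightarrow> ('b \<Rightarrow> 'c) \<Rightarrow> bool" where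
  "interp_map \<iota> B A H \<longleftrightarrow> H ` int_dom \<iota> B = carrier A \<and>
     (\<forall>b0\<in>int_dom \<iota> B. \<forall>b1\<in>int_dom \<iota> B. \<forall>b2\<in>int_dom \<iota> B.
        sat B (b0 ## b1 ## (\<lambda>_. b2)) (Add_fm \<iota>) \<longleftrightarrow> H b0 = add A (H b1) (H b2))"

lemma interprets_in_struct_interp_map:
  fixes B :: "'a struct"
  assumes "interprets_in_struct \<iota> S B"
  obtains A :: "'a set struct" and H where "is_model A S" "interp_map \<iota> B A H"
proof -
  obtain A :: "'a set struct" and h where A: "is_model A S"
    and h: "bij_betw h (int_dom \<iota> B // int_rel \<iota> B) (carrier A)"
    and add: "\<And>b0 b1 b2. b0 \<in> int_dom \<iota> B \<Longrightarrow> b1 \<in> int_dom \<iota> B \<Longrightarrow> b2 \<in> int_dom \<iota> B \<Longrightarrow>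
        h (int_rel \<iota> B `` {b0}) = add A (h (int_rel \<iota> B `` {b1})) (h (int_rel \<iota> B `` {b2}))
        \<longleftrightarrow> sat B (b0 ## b1 ## (\<lambda>_. b2)) (Add_fm \<iota>)"
    using assms unfolding interprets_in_struct_def interprets_struct_def by blast
  have Q: "int_dom \<iota> B // int_rel \<iota> B = (\<lambda>b. int_rel \<iota> B `` {b}) ` int_dom \<iota> B"
    unfolding quotient_def by (rule UNION_singleton_eq_range)
  have "(\<lambda>b. h (int_rel \<iota> B `` {b})) ` int_dom \<iota> B = carrier A"
    using bij_betw_imp_surj_on[OF h] unfolding Q image_image .
  then have "interp_map \<iota> B A (\<lambda>b. h (int_rel \<iota> B `` {b}))"
    unfolding interp_map_def using add by (intro conjI ballI) auto
  then show ?thesis by (rule that[OF A])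
qed

lemma interp_map_iso:
  assumes iso: "struct_iso j M N" and M: "is_struct M" and H: "interp_map \<iota> N A H"
  shows "interp_map \<iota> M A (\<lambda>x. H (j x))"
proof -
  have N: "carrier N = j ` carrier M" using iso by (auto simp: struct_iso_def bij_betw_def)
  have dom: "j x \<in> int_dom \<iota> N \<longleftrightarrow> x \<in> int_dom \<iota> M" if "x \<in> carrier M" for x
    using sat_iso[OF iso M, of "\<lambda>_. x"] that N by (auto simp: int_dom_def)
  then have D: "int_dom \<iota> N = j ` int_dom \<iota> M"
    using N by (auto simp: int_dom_def)
  have "sat N (j b0 ## j b1 ## (\<lambda>_. j b2)) \<phi> \<longleftrightarrow> sat M (b0 ## b1 ## (\<lambda>_. b2)) \<phi>"
    if "b0 \<in> carrier M" "b1 \<in> carrier M" "b2 \<in> carrier M" for b0 b1 b2 \<phi>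
  proof -
    have "j b0 ## j b1 ## (\<lambda>_. j b2) = (\<lambda>n. j ((b0 ## b1 ## (\<lambda>_. b2)) n))"
      by (rule ext) (simp split: nat.split)
    then show ?thesis
      using sat_iso[OF iso M, of "b0 ## b1 ## (\<lambda>_. b2)"] that by (simp add: range_scons)
  qed
  then show ?thesis
    using H unfolding interp_map_def D by (auto simp: image_image int_dom_def)
qed

section \<open>Back and forth between discretely ordered groups\<close>

text \<open>A discretely ordered group with Euclidean division, as in models of Presburger
  arithmetic, except by multiples of \<open>p\<close>. The ambient ring supplies the order and the
  integer multiples. No bound is put on \<open>r\<close>, since multiples of \<open>m\<close> can be
  moved into \<open>w\<close>.\<close>

definition zgroup :: "nat \<Rightarrow> 'g::linordered_idom set \<Rightarrow> bool" where
  "zgroup p Z \<longleftrightarrow> 1 \<in> Z \<and> (\<forall>x\<in>Z. \<forall>y\<in>Z. x - y \<in> Z) \<and> (\<forall>x\<in>Z. 0 < x \<longrightarrow> 1 \<le> x) \<and>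
    (\<forall>m>0. \<not> p dvd m \<longrightarrow> (\<forall>x\<in>Z. \<exists>w\<in>Z. \<exists>r. x = of_nat m * w + of_int r))"

definition cone :: "'g::linordered_idom set \<Rightarrow> 'g struct" where
  "cone Z = \<lparr>carrier = {x \<in> Z. 0 \<le> x}, add = (+)\<rparr>"

lemma cone_simps [simp]: "carrier (cone Z) = {x \<in> Z. 0 \<le> x}" "add (cone Z) = (+)"
  by (simp_all add: cone_def)

context
  fixes p :: nat and Z :: "'g::linordered_idom set"
  assumes Z: "zgroup p Z"
begin

lemma zgroup_one: "1 \<in> Z" and zgroup_diff: "x \<in> Z \<Longrightarrow> y \<in> Z \<Longrightarrow> x - y \<in> Z"
  and zgroup_discrete: "x \<in> Z \<Longrightarrow> 0 < x \<Longrightarrow> 1 \<le> x"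
  and zgroup_div: "m > 0 \<Longrightarrow> \<not> p dvd m \<Longrightarrow> x \<in> Z \<Longrightarrow> \<exists>w\<in>Z. \<exists>r. x = of_nat m * w + of_int r"
  using Z by (auto simp: zgroup_def)

lemma zgroup_zero: "0 \<in> Z"
  using zgroup_diff[OF zgroup_one zgroup_one] by simp

lemma zgroup_uminus: "x \<in> Z \<Longrightarrow> - x \<in> Z"
  using zgroup_diff[OF zgroup_zero] by simp

lemma zgroup_add: "x \<in> Z \<Longrightarrow> y \<in> Z \<Longrightarrow> x + y \<in> Z"
  using zgroup_diff[of x "- y"] zgroup_uminus by simp

lemma zgroup_of_nat_mult: "x \<in> Z \<Longrightarrow> of_nat n * x \<in> Z"
  by (induction n) (auto simp: zgroup_zero zgroup_add distrib_right)

lemma zgroup_of_int_mult: "x \<in> Z \<Longrightarrow> of_int i * x \<in> Z"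
  using zgroup_of_nat_mult zgroup_uminus by (cases i rule: int_cases2) auto

lemma zgroup_of_int: "of_int i \<in> Z"
  using zgroup_of_int_mult[OF zgroup_one] by simp

lemma zgroup_sum: "(\<And>i. i \<in> I \<Longrightarrow> f i \<in> Z) \<Longrightarrow> sum f I \<in> Z"
  by (induction I rule: infinite_finite_induct) (auto simp: zgroup_zero zgroup_add)

text \<open>Discreteness allows 1 to be subtracted until 0 is reached, so elements at a finite
  distance from 0 are standard integers.\<close>

lemma zgroup_bounded: "x \<in> Z \<Longrightarrow> 0 \<le> x \<Longrightarrow> x \<le> of_nat n \<Longrightarrow> \<exists>i. x = of_int i"
proof (induction n arbitrary: x)
  case 0
  then have "x = of_int 0" by simp
  then show ?case ..
next
  case (Suc n)
  show ?case
  proof (cases "x = 0")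
    case False
    then have "x - 1 \<in> Z" "0 \<le> x - 1" using Suc.prems zgroup_discrete zgroup_diff zgroup_one by auto
    moreover have "x - 1 \<le> of_nat n" using Suc.prems(3) by (simp add: algebra_simps)
    ultimately obtain i where "x - 1 = of_int i" using Suc.IH by blast
    then have "x = of_int (i + 1)" by (simp add: algebra_simps)
    then show ?thesis ..
  qed (metis of_int_0)
qed

text \<open>Since \<open>m \<ge> 1\<close>, the absolute value of \<open>z\<close> is bounded by
  that of \<open>i\<close>. A congruence between integers that holds in \<open>Z\<close> thus holds
  in the integers, and can be carried to another group.\<close>

lemma zgroup_multiple_integer:
  assumes "z \<in> Z" "of_int i = of_nat m * z" "m > 0"
  shows "\<exists>z'. z = of_int z'"
proof -
  have *: "\<exists>z'. z = of_int z'" if "z \<in> Z" "0 \<le> z" "of_int i = of_nat m * z" for z i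
  proof -
    have "1 * z \<le> of_nat m * z" using that(2) \<open>m > 0\<close> by (intro mult_right_mono) auto
    also have "\<dots> = of_int i" using that by simp
    also have "\<dots> \<le> of_int \<bar>i\<bar>" by (simp del: of_int_abs)
    finally show ?thesis using zgroup_bounded[OF that(1,2), of "nat \<bar>i\<bar>"] by simp
  qed
  show ?thesis
  proof (cases "0 \<le> z")
    case False
    then have "\<exists>z'. - z = of_int z'" using *[of "- z" "- i"] assms zgroup_uminus by simp
    then show ?thesis by (metis minus_minus of_int_minus)
  qed (use * assms in blast)
qed

end

section \<open>Linear forms and the back-and-forth relation\<close>

definition lin :: "nat \<Rightarrow> (nat \<Rightarrow> int) \<Rightarrow> (nat \<Rightarrow> 'g::linordered_idom) \<Rightarrow> 'g" where
  "lin k a e = (\<Sum>i<k. of_int (a i) * e i)"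

lemma lin_Suc: "lin (Suc k) a (x ## e) = of_int (a 0) * x + lin k (\<lambda>i. a (Suc i)) e"
  unfolding lin_def by (simp add: sum.lessThan_Suc_shift del: sum.lessThan_Suc)

lemma lin_add: "lin k (\<lambda>i. a i + b i) e = lin k a e + lin k b e"
  by (simp add: lin_def distrib_right sum.distrib)

lemma lin_diff: "lin k (\<lambda>i. a i - b i) e = lin k a e - lin k b e"
  by (simp add: lin_def left_diff_distrib sum_subtractf)

lemma lin_minus: "lin k (\<lambda>i. - a i) e = - lin k a e"
  by (simp add: lin_def sum_negf)

lemma lin_scale: "lin k (\<lambda>i. q * a i) e = of_int q * lin k a e"
  by (simp add: lin_def sum_distrib_left mult.assoc)

lemma lin_zero: "lin k (\<lambda>i. 0) e = 0"
  by (simp add: lin_def)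

text \<open>Only the values of \<open>a\<close> below \<open>k\<close> matter, so the coefficients
  may be taken from a finite function space.\<close>

lemma finite_lin:
  fixes e :: "nat \<Rightarrow> 'g::linordered_idom"
  shows "finite {lin k a e + of_int c | a c. (\<forall>i<k. \<bar>a i\<bar> \<le> int R) \<and> \<bar>c\<bar> \<le> int R}"
proof -
  let ?F = "{..<k} \<rightarrow>\<^sub>E {- int R..int R}"
  have "finite (?F \<times> {- int R..int R})" by (intro finite_cartesian_product finite_PiE) auto
  moreover have "{lin k a e + of_int c | a c. (\<forall>i<k. \<bar>a i\<bar> \<le> int R) \<and> \<bar>c\<bar> \<le> int R}
    \<subseteq> (\<lambda>(a, c). lin k a e + of_int c) ` (?F \<times> {- int R..int R})"
  proof
    fix v assume "v \<in> {lin k a e + of_int c | a c. (\<forall>i<k. \<bar>a i\<bar> \<le> int R) \<and> \<bar>c\<bar> \<le> int R}"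
    then obtain a c where v: "v = lin k a e + of_int c"
      and *: "\<forall>i<k. \<bar>a i\<bar> \<le> int R" "\<bar>c\<bar> \<le> int R" by blast
    have "lin k a e = lin k (restrict a {..<k}) e" by (simp add: lin_def)
    moreover have "restrict a {..<k} \<in> ?F"
      by (rule restrict_PiE_iff[THEN iffD2]) (use *(1) in \<open>auto simp: abs_le_iff minus_le_iff\<close>)
    ultimately show "v \<in> (\<lambda>(a, c). lin k a e + of_int c) ` (?F \<times> {- int R..int R})"
      unfolding v using *(2) by (intro image_eqI[where x = "(restrict a {..<k}, c)"]) auto
  qed
  ultimately show ?thesis using finite_surj by blast
qed

text \<open>A position of the back-and-forth game. Positivity alone fixes the full sign of a form,
  because negated coefficients and constants obey the same bound. The shared \<open>r\<close>
  expresses equal residues modulo \<open>M\<close> across two different groups.\<close>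

definition eqv ::
    "'g::linordered_idom set \<Rightarrow> 'g set \<Rightarrow> nat \<Rightarrow> nat \<Rightarrow> nat \<Rightarrow> (nat \<Rightarrow> 'g) \<Rightarrow> (nat \<Rightarrow> 'g) \<Rightarrow> bool" where
  "eqv Z1 Z2 C M k e1 e2 \<longleftrightarrow>
    (\<forall>a c. (\<forall>i<k. \<bar>a i\<bar> \<le> int C) \<and> \<bar>c\<bar> \<le> int C \<longrightarrow>
       (0 < lin k a e1 + of_int c \<longleftrightarrow> 0 < lin k a e2 + of_int c)) \<and>
    (\<forall>i<k. \<exists>r. \<exists>w1\<in>Z1. \<exists>w2\<in>Z2. e1 i = of_nat M * w1 + of_int r \<and> e2 i = of_nat M * w2 + of_int r)"

lemma eqv_sym: "eqv Z1 Z2 C M k e1 e2 \<Longrightarrow> eqv Z2 Z1 C M k e2 e1"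
  unfolding eqv_def by metis

lemma eqv_signD:
  assumes "eqv Z1 Z2 C M k e1 e2" "\<And>i. i < k \<Longrightarrow> \<bar>a i\<bar> \<le> int C" "\<bar>c\<bar> \<le> int C"
  shows "0 < lin k a e1 + of_int c \<longleftrightarrow> 0 < lin k a e2 + of_int c"
  using assms by (simp add: eqv_def)

lemma eqv_resD:
  assumes "eqv Z1 Z2 C M k e1 e2" "i < k"
  shows "\<exists>r. \<exists>w1\<in>Z1. \<exists>w2\<in>Z2. e1 i = of_nat M * w1 + of_int r \<and> e2 i = of_nat M * w2 + of_int r"
  using assms by (simp add: eqv_def)

lemma eqv_mono:
  assumes "eqv Z1 Z2 C' M' k e1 e2" "C \<le> C'" "M dvd M'" "zgroup p Z1" "zgroup p Z2"
  shows "eqv Z1 Z2 C M k e1 e2"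
  unfolding eqv_def
proof (intro conjI HOL.allI HOL.impI) \<comment> \<open>plain \<open>allI\<close> and \<open>impI\<close> are now rules of \<open>\<turnstile>\<close>\<close>
  fix a c assume *: "(\<forall>i<k. \<bar>a i\<bar> \<le> int C) \<and> \<bar>c\<bar> \<le> int C"
  have "\<bar>a i\<bar> \<le> int C'" if "i < k" for i using * assms(2) that by (meson of_nat_le_iff order_trans)
  moreover have "\<bar>c\<bar> \<le> int C'" using * assms(2) by linarith
  ultimately show "0 < lin k a e1 + of_int c \<longleftrightarrow> 0 < lin k a e2 + of_int c"
    by (rule eqv_signD[OF assms(1)])
next
  fix i assume "i < k"
  then obtain r w1 w2 where w: "w1 \<in> Z1" "w2 \<in> Z2" "e1 i = of_nat M' * w1 + of_int r"
    "e2 i = of_nat M' * w2 + of_int r" using eqv_resD[OF assms(1)] by blast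
  obtain q where q: "M' = M * q" using assms(3) by blast
  have "of_nat q * w1 \<in> Z1" "of_nat q * w2 \<in> Z2"
    using w assms(4,5) zgroup_of_nat_mult by blast+
  moreover have "e1 i = of_nat M * (of_nat q * w1) + of_int r" "e2 i = of_nat M * (of_nat q * w2) + of_int r"
    using w q by (auto simp: mult.assoc)
  ultimately show "\<exists>r. \<exists>w1\<in>Z1. \<exists>w2\<in>Z2. e1 i = of_nat M * w1 + of_int r \<and> e2 i = of_nat M * w2 + of_int r"
    by blast
qed

text \<open>The residues of the entries are common to both sides, so one integer combination of them
  serves both.\<close>

lemma lin_residue:
  assumes "eqv Z1 Z2 C M k e1 e2" "zgroup p Z1" "zgroup p Z2"
  obtains r w1 w2 where "w1 \<in> Z1" "w2 \<in> Z2"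
    "lin k b e1 = of_nat M * w1 + of_int r" "lin k b e2 = of_nat M * w2 + of_int r"
proof -
  have "\<forall>i. \<exists>r w1 w2. i < k \<longrightarrow> w1 \<in> Z1 \<and> w2 \<in> Z2 \<and> e1 i = of_nat M * w1 + of_int r
      \<and> e2 i = of_nat M * w2 + of_int r"
    using eqv_resD[OF assms(1)] by blast
  then obtain r w1 w2 where w: "\<And>i. i < k \<Longrightarrow> w1 i \<in> Z1 \<and> w2 i \<in> Z2
      \<and> e1 i = of_nat M * w1 i + of_int (r i) \<and> e2 i = of_nat M * w2 i + of_int (r i)"
    by metis
  have e: "lin k b e = of_nat M * (\<Sum>i<k. of_int (b i) * w i) + of_int (\<Sum>i<k. b i * r i)"
    if "\<And>i. i < k \<Longrightarrow> e i = of_nat M * w i + of_int (r i)" for e w :: "nat \<Rightarrow> 'a"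
    unfolding lin_def by (simp add: that sum_distrib_left sum.distrib algebra_simps)
  have "(\<Sum>i<k. of_int (b i) * w1 i) \<in> Z1" "(\<Sum>i<k. of_int (b i) * w2 i) \<in> Z2"
    using w assms(2,3) by (auto intro!: zgroup_sum zgroup_of_int_mult)
  then show ?thesis using that e[of e1 w1] e[of e2 w2] w by blast
qed

text \<open>The new element is approximated from below by the largest threshold \<open>t\<close>.  Either it lies an
  integer distance of at most \<open>m\<close> above \<open>t\<close>, or every residue modulo \<open>m\<close> is represented between
  \<open>t\<close> and the next threshold.\<close>

lemma threshold:
  fixes Z :: "'g::linordered_idom set"
  assumes Z: "zgroup p Z" and m: "m > 0" "\<not> p dvd m" and u: "u \<in> Z" "0 \<le> u"
    and T: "finite T" "T \<subseteq> Z" "0 \<in> T"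
  obtains t j w where "t \<in> T" "0 \<le> j" "j \<le> int m" "w \<in> Z" "u - t = of_nat m * w + of_int j"
    "\<And>s. s \<in> T \<Longrightarrow> (0 < u - s \<longleftrightarrow> 0 < t + of_int j - s) \<and> (0 < s - u \<longleftrightarrow> 0 < s - t - of_int j)"
proof -
  define t where "t = Max {s \<in> T. s \<le> u}"
  have "t \<in> {s \<in> T. s \<le> u}" unfolding t_def using T u by (intro Max_in) auto
  then have t: "t \<in> T" "t \<le> u" by auto
  have tmax: "s \<le> t" if "s \<in> T" "s \<le> u" for s
    unfolding t_def using T that by (intro Max_ge) auto
  have v: "u - t \<in> Z" using zgroup_diff[OF Z] u t T by auto
  show ?thesis
  proof (cases "u - t \<le> of_nat m")
    case True
    then obtain j where j: "u - t = of_int j" using zgroup_bounded[OF Z v] t by auto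
    have "of_int 0 \<le> (of_int j :: 'g)" "of_int j \<le> (of_int (int m) :: 'g)"
      using True j t by (metis diff_ge_0_iff_ge of_int_0, simp)
    then have "0 \<le> j" "j \<le> int m" by (simp_all only: of_int_le_iff)
    moreover have u: "u = t + of_int j" using j by (simp add: algebra_simps)
    ultimately show ?thesis using t that[of t j 0] zgroup_zero[OF Z] by (simp add: algebra_simps)
  next
    case False
    obtain w r where w: "w \<in> Z" "u - t = of_nat m * w + of_int r"
      using zgroup_div[OF Z m v] by (elim bexE exE) (rule that)
    \<comment> \<open>The residue is represented in \<open>1..m\<close> instead of
      \<open>0..m-1\<close>, so that \<open>t + j\<close> lies strictly above \<open>t\<close>. As
      \<open>u - t > m\<close>, it also lies below \<open>u\<close>, hence in the same gap between
      thresholds.\<close>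
    define j where "j = (r - 1) mod int m + 1"
    have j: "1 \<le> j" "j \<le> int m" unfolding j_def using m pos_mod_bound[of "int m" "r - 1"] pos_mod_sign[of "int m" "r - 1"] by linarith+
    have r: "r = int m * ((r - 1) div int m) + j" unfolding j_def by simp
    have "of_nat m * w + of_int r = of_nat m * (w + of_int ((r - 1) div int m)) + of_int j"
      by (subst r) (simp add: distrib_left)
    moreover have "w + of_int ((r - 1) div int m) \<in> Z" using w zgroup_add[OF Z] zgroup_of_int[OF Z] by blast
    moreover have "(0 < u - s \<longleftrightarrow> 0 < t + of_int j - s) \<and> (0 < s - u \<longleftrightarrow> 0 < s - t - of_int j)"
      if s: "s \<in> T" for s
    proof -
      have j': "(1::'g) \<le> of_int j" "of_int j \<le> (of_nat m :: 'g)"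
        using j by (simp, metis of_int_le_iff of_int_of_nat_eq)
      have gap: "of_nat m < u - t" "(0::'g) \<le> of_nat m" using False by simp_all
      show ?thesis
      proof (cases "s \<le> u")
        case True
        then have "s \<le> t" using s tmax by blast
        then show ?thesis using gap j' by (intro conjI iffI) linarith+
      next
        case False
        then show ?thesis using gap j' by (intro conjI iffI) linarith+
      qed
    qed
    ultimately show ?thesis using that[of t j] t j w by auto
  qed
qed

text \<open>With \<open>Q = C!\<close>, every inequality in which \<open>x\<close> has a nonzero
  coefficient of size at most \<open>C\<close> can be multiplied so that \<open>x\<close> occurs as
  \<open>Q x\<close>; it then compares \<open>Q x\<close> with a form whose coefficients are at most
  \<open>R = Q C\<close>. The largest such threshold below \<open>Q x\<close> is copied to the other
  side, and the copy of \<open>Q x\<close> is divided by \<open>Q\<close>. Differences of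
  thresholds, shifted by at most \<open>Q M\<close>, stay within the bound
  \<open>2 R + 2 Q M\<close>; the division by \<open>Q\<close> that keeps residues modulo
  \<open>M\<close> uses residues modulo \<open>Q M\<close>.\<close>

lemma back_and_forth:
  fixes Z1 Z2 :: "'g::linordered_idom set"
  assumes Z1: "zgroup p Z1" and Z2: "zgroup p Z2" and M: "M > 0" and p: "\<not> p dvd fact C * M" "\<not> p dvd M"
    and eqv: "eqv Z1 Z2 (2 * fact C * (C + M)) (fact C * M) k e1 e2"
    and e1: "\<And>i. i < k \<Longrightarrow> e1 i \<in> Z1" and x: "x \<in> Z1" "0 \<le> x"
  shows "\<exists>y\<in>Z2. 0 \<le> y \<and> eqv Z1 Z2 C M (Suc k) (x ## e1) (y ## e2)"
proof -
  define Q where "Q = (fact C :: nat)"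
  define R where "R = Q * C"
  have Q: "Q > 0" and QM: "Q * M > 0" using M by (simp_all add: Q_def)
  have C': "2 * fact C * (C + M) = 2 * R + 2 * (Q * M)"
    by (simp add: Q_def R_def algebra_simps)
  have eqv: "eqv Z1 Z2 (2 * R + 2 * (Q * M)) (Q * M) k e1 e2"
    using eqv C' by (simp add: Q_def)
  define T where "T = {lin k a e1 + of_int c | a c. (\<forall>i<k. \<bar>a i\<bar> \<le> int R) \<and> \<bar>c\<bar> \<le> int R}"
  have TZ: "T \<subseteq> Z1"
    unfolding T_def lin_def using e1 Z1 by (auto intro!: zgroup_add zgroup_sum zgroup_of_int_mult zgroup_of_int)
  have T0: "0 \<in> T" unfolding T_def by (auto intro!: exI[where x = "\<lambda>_. 0"] exI[where x = 0] simp: lin_zero)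
  have "finite T" unfolding T_def by (rule finite_lin)
  moreover have "of_nat Q * x \<in> Z1" "0 \<le> of_nat Q * x" using x Q zgroup_of_nat_mult[OF Z1] by auto
  moreover have "\<not> p dvd Q * M" using p(1) by (simp add: Q_def)
  ultimately obtain t j w where t: "t \<in> T" and j: "0 \<le> j" "j \<le> int (Q * M)" and w: "w \<in> Z1"
      "of_nat Q * x - t = of_nat (Q * M) * w + of_int j" and
    sgn: "\<And>s. s \<in> T \<Longrightarrow> (0 < of_nat Q * x - s \<longleftrightarrow> 0 < t + of_int j - s) \<and>
      (0 < s - of_nat Q * x \<longleftrightarrow> 0 < s - t - of_int j)"
    using threshold[OF Z1 QM _ _ _ _ TZ T0, of "of_nat Q * x"] by blast
  obtain b c where b: "\<And>i. i < k \<Longrightarrow> \<bar>b i\<bar> \<le> int R" "\<bar>c\<bar> \<le> int R" "t = lin k b e1 + of_int c"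
    using t unfolding T_def by blast
  define t2 where "t2 = lin k b e2 + of_int c"
  obtain r w1 w2 where r: "w1 \<in> Z1" "w2 \<in> Z2" "lin k b e1 = of_nat (Q * M) * w1 + of_int r"
      "lin k b e2 = of_nat (Q * M) * w2 + of_int r"
    by (rule lin_residue[OF eqv Z1 Z2])
  obtain w0 rx where rx: "w0 \<in> Z1" "x = of_nat M * w0 + of_int rx"
    using zgroup_div[OF Z1 M p(2) x(1)] by (elim bexE exE) (rule that)
  \<comment> \<open>This writes \<open>Q x\<close> in two ways, through \<open>t\<close> and through
    the residue \<open>rx\<close> of \<open>x\<close>. The quotient turns out to be an integer, so
    \<open>r + c + j\<close> is congruent to \<open>Q rx\<close> modulo \<open>Q M\<close>
    independently of the group \<open>Z1\<close>.\<close>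
  have "of_int (r + c + j - int Q * rx) = of_nat (Q * M) * (w0 - w - w1)"
    using w(2) b(3) r(3) rx(2) by (simp add: algebra_simps)
  moreover have "w0 - w - w1 \<in> Z1" using rx w r zgroup_diff[OF Z1] by blast
  ultimately obtain z where "w0 - w - w1 = of_int z" and
    eq: "(of_int (r + c + j - int Q * rx) :: 'g) = of_nat (Q * M) * of_int z"
    using zgroup_multiple_integer[OF Z1 _ _ QM] by metis
  have "r + c + j - int Q * rx = int (Q * M) * z"
    using eq by (metis of_int_eq_iff of_int_mult of_int_of_nat_eq)
  then have rcj: "r + c + j = int Q * rx + int (Q * M) * z" by simp
  \<comment> \<open>Chosen so that \<open>Q y = t2 + j\<close>, with the same residue
    \<open>rx\<close> modulo \<open>M\<close> as \<open>x\<close>.\<close>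
  define y where "y = of_nat M * (w2 + of_int z) + of_int rx"
  have y: "y \<in> Z2" unfolding y_def using r Z2 by (intro zgroup_add zgroup_of_nat_mult zgroup_of_int)
  have "t2 + of_int j = of_nat (Q * M) * w2 + of_int (r + c + j)"
    unfolding t2_def r(4) by simp
  also have "\<dots> = of_nat Q * y"
    unfolding rcj y_def by (simp add: algebra_simps)
  finally have Qy: "of_nat Q * y = t2 + of_int j" ..
  \<comment> \<open>On the first side, replacing \<open>Q x\<close> by \<open>t + j\<close>
    preserves comparisons with thresholds. The difference of two thresholds is again a form, to
    which the given equivalence applies.\<close>
  have key: "(0 < of_nat Q * x - (lin k a e1 + of_int d) \<longleftrightarrow> 0 < of_nat Q * y - (lin k a e2 + of_int d)) \<and>
     (0 < (lin k a e1 + of_int d) - of_nat Q * x \<longleftrightarrow> 0 < (lin k a e2 + of_int d) - of_nat Q * y)"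
    if a: "\<And>i. i < k \<Longrightarrow> \<bar>a i\<bar> \<le> int R" "\<bar>d\<bar> \<le> int R" for a d
  proof -
    let ?s1 = "lin k a e1 + of_int d" and ?s2 = "lin k a e2 + of_int d"
    have T: "?s1 \<in> T" unfolding T_def using a by blast
    have bd: "\<bar>b i - a i\<bar> \<le> int (2 * R + 2 * (Q * M))" "\<bar>a i - b i\<bar> \<le> int (2 * R + 2 * (Q * M))" if "i < k" for i
      using a(1)[OF that] b(1)[OF that] by linarith+
    have cd: "\<bar>c + j - d\<bar> \<le> int (2 * R + 2 * (Q * M))" "\<bar>d - c - j\<bar> \<le> int (2 * R + 2 * (Q * M))"
      using a(2) b(2) j by linarith+
    have "0 < t + of_int j - ?s1 \<longleftrightarrow> 0 < t2 + of_int j - ?s2"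
      using eqv_signD[OF eqv bd(1) cd(1)] unfolding b(3) t2_def by (simp add: lin_diff algebra_simps)
    moreover have "0 < ?s1 - t - of_int j \<longleftrightarrow> 0 < ?s2 - t2 - of_int j"
      using eqv_signD[OF eqv bd(2) cd(2)] unfolding b(3) t2_def by (simp add: lin_diff algebra_simps)
    ultimately show ?thesis using sgn[OF T] Qy by (simp add: algebra_simps)
  qed
  \<comment> \<open>The zero form is a threshold, so \<open>y\<close> inherits nonnegativity from
    \<open>x\<close>.\<close>
  have "\<not> 0 < 0 - of_nat Q * y"
    using key[of "\<lambda>_. 0" 0] x Q by (simp add: lin_zero zero_less_mult_iff mult_less_0_iff)
  then have y0: "0 \<le> y" using Q by (simp add: mult_less_0_iff not_less)
  have "eqv Z1 Z2 C M (Suc k) (x ## e1) (y ## e2)"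
    unfolding eqv_def
  proof (intro conjI HOL.allI HOL.impI)
    fix a d assume a: "(\<forall>i<Suc k. \<bar>a i\<bar> \<le> int C) \<and> \<bar>d\<bar> \<le> int C"
    define a' where "a' = (\<lambda>i. a (Suc i))"
    have a': "\<And>i. i < k \<Longrightarrow> \<bar>a' i\<bar> \<le> int C" using a by (auto simp: a'_def)
    have a0: "\<bar>a 0\<bar> \<le> int C" using a by auto
    have CR: "C \<le> R" unfolding R_def using Q by (cases Q) auto
    show "0 < lin (Suc k) a (x ## e1) + of_int d \<longleftrightarrow> 0 < lin (Suc k) a (y ## e2) + of_int d"
    proof (cases "a 0 = 0")
      case True
      have "0 < lin k a' e1 + of_int d \<longleftrightarrow> 0 < lin k a' e2 + of_int d"
      proof (rule eqv_signD[OF eqv])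
        show "\<bar>a' i\<bar> \<le> int (2 * R + 2 * (Q * M))" if "i < k" for i
          using a'[OF that] CR by linarith
        show "\<bar>d\<bar> \<le> int (2 * R + 2 * (Q * M))" using a CR by linarith
      qed
      then show ?thesis using True by (simp add: lin_Suc a'_def)
    next
      case False
      \<comment> \<open>The factor \<open>q = Q / \<bar>a 0\<bar>\<close> turns the coefficient
        \<open>a 0\<close> into \<open>Q\<close> or \<open>- Q\<close>, and the remaining ones stay
        at most \<open>R\<close>.\<close>
      have "nat \<bar>a 0\<bar> dvd Q" unfolding Q_def using False a0 by (intro dvd_fact) auto
      then obtain q where q: "Q = nat \<bar>a 0\<bar> * q" by blast
      have q0: "q > 0" using q Q by (cases q) auto
      have qQ: "int q \<le> int Q" using q Q False by (cases "nat \<bar>a 0\<bar>") auto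
      have bnd: "\<bar>int q * f\<bar> \<le> int R" if "\<bar>f\<bar> \<le> int C" for f
        unfolding R_def using mult_mono[OF qQ that] by (simp add: abs_mult)
      have pos: "0 < v \<longleftrightarrow> 0 < of_nat q * v" for v :: 'g
        using q0 by (simp add: zero_less_mult_iff)
      have intQ: "int Q = \<bar>a 0\<bar> * int q" unfolding q by simp
      show ?thesis
      proof (cases "a 0 > 0")
        case True
        have Qz: "of_nat q * (of_int (a 0) * z) = of_nat Q * z" for z :: 'g
        proof -
          have "of_nat Q = (of_int (int Q) :: 'g)" by simp
          also have "\<dots> = of_int (a 0) * of_nat q" unfolding intQ using True by simp
          finally show ?thesis by (simp add: mult.assoc mult.left_commute)
        qed
        have "0 < of_nat Q * x - (lin k (\<lambda>i. - (int q * a' i)) e1 + of_int (- (int q * d))) \<longleftrightarrow>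
              0 < of_nat Q * y - (lin k (\<lambda>i. - (int q * a' i)) e2 + of_int (- (int q * d)))"
          using key[of "\<lambda>i. - (int q * a' i)" "- (int q * d)"] bnd a a' by auto
        moreover have "of_nat q * (lin (Suc k) a (z ## e) + of_int d) =
            of_nat Q * z - (lin k (\<lambda>i. - (int q * a' i)) e + of_int (- (int q * d)))" for z :: 'g and e
          unfolding lin_Suc lin_minus lin_scale by (simp add: distrib_left Qz a'_def)
        ultimately show ?thesis
          using pos[of "lin (Suc k) a (x ## e1) + of_int d"] pos[of "lin (Suc k) a (y ## e2) + of_int d"]
          by presburger
      next
        case neg: False
        have Qz: "of_nat q * (of_int (a 0) * z) = - (of_nat Q * z)" for z :: 'g
        proof -
          have "of_nat Q = (of_int (int Q) :: 'g)" by simp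
          also have "\<dots> = - of_int (a 0) * of_nat q" unfolding intQ using neg by simp
          finally show ?thesis by (simp add: mult.assoc mult.left_commute)
        qed
        have "0 < (lin k (\<lambda>i. int q * a' i) e1 + of_int (int q * d)) - of_nat Q * x \<longleftrightarrow>
              0 < (lin k (\<lambda>i. int q * a' i) e2 + of_int (int q * d)) - of_nat Q * y"
          using key[of "\<lambda>i. int q * a' i" "int q * d"] bnd a a' by auto
        moreover have "of_nat q * (lin (Suc k) a (z ## e) + of_int d) =
            (lin k (\<lambda>i. int q * a' i) e + of_int (int q * d)) - of_nat Q * z" for z :: 'g and e
          unfolding lin_Suc lin_scale by (simp add: distrib_left Qz a'_def)
        ultimately show ?thesis
          using pos[of "lin (Suc k) a (x ## e1) + of_int d"] pos[of "lin (Suc k) a (y ## e2) + of_int d"]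
          by presburger
      qed
    qed
  next
    fix i assume i: "i < Suc k"
    show "\<exists>r. \<exists>w1\<in>Z1. \<exists>w2\<in>Z2. (x ## e1) i = of_nat M * w1 + of_int r \<and> (y ## e2) i = of_nat M * w2 + of_int r"
    proof (cases i)
      case 0
      have "w2 + of_int z \<in> Z2" using r zgroup_add[OF Z2] zgroup_of_int[OF Z2] by blast
      then show ?thesis unfolding 0 using rx y_def by auto
    next
      case (Suc i')
      have "eqv Z1 Z2 0 M k e1 e2" using eqv_mono[OF eqv _ _ Z1 Z2, of 0 M] by simp
      then show ?thesis using eqv_resD[of Z1 Z2 0 M k e1 e2 i'] i Suc by simp
    qed
  qed
  then show ?thesis using y y0 by blast
qed

section \<open>Invariance of formulas under the back-and-forth relation\<close>

primrec occ :: "tm \<Rightarrow> nat \<Rightarrow> int" where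
  "occ (Var n) = (\<lambda>i. if i = n then 1 else 0)"
| "occ (Add s t) = (\<lambda>i. occ s i + occ t i)"

lemma eval_cone: "fv_tm t \<subseteq> {..<k} \<Longrightarrow> eval (cone Z) e t = lin k (occ t) e"
proof (induction t)
  case (Var n)
  have "lin k (occ (Var n)) e = (\<Sum>i<k. if i = n then e i else 0)"
    unfolding lin_def by (intro sum.cong) auto
  then show ?case using Var by simp
qed (simp add: lin_add)

lemma occ_bound: "\<exists>C. \<forall>i. \<bar>occ t i\<bar> \<le> int C"
proof (induction t)
  case (Var n)
  show ?case by (intro exI[of _ 1]) simp
next
  case (Add s t)
  then obtain C D where "\<forall>i. \<bar>occ s i\<bar> \<le> int C" "\<forall>i. \<bar>occ t i\<bar> \<le> int D" by blast
  then have "\<bar>occ s i + occ t i\<bar> \<le> int (C + D)" for i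
    using abs_triangle_ineq[of "occ s i" "occ t i"] add_mono[of "\<bar>occ s i\<bar>" "int C" "\<bar>occ t i\<bar>" "int D"] by simp
  then show ?case by (intro exI[of _ "C + D"]) simp
qed

text \<open>One choice of \<open>C\<close>, \<open>M\<close> and \<open>K\<close> must serve all
  pairs of groups and all \<open>p > K\<close> at once; this uniformity is what allows truth to pass
  between groups.\<close>

definition invariant :: "'g::linordered_idom itself \<Rightarrow> fm \<Rightarrow> nat \<Rightarrow> nat \<Rightarrow> nat \<Rightarrow> nat \<Rightarrow> bool" where
  "invariant _ \<phi> k C M K \<longleftrightarrow> M > 0 \<and> (\<forall>p>K. \<forall>(Z1::'g set) Z2. zgroup p Z1 \<longrightarrow> zgroup p Z2 \<longrightarrow>
    (\<forall>e1 e2. range e1 \<subseteq> carrier (cone Z1) \<longrightarrow> range e2 \<subseteq> carrier (cone Z2) \<longrightarrow>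
       eqv Z1 Z2 C M k e1 e2 \<longrightarrow> (sat (cone Z1) e1 \<phi> \<longleftrightarrow> sat (cone Z2) e2 \<phi>)))"

lemma invariantI:
  fixes \<phi> :: fm
  assumes "M > 0"
    "\<And>p (Z1::'g::linordered_idom set) Z2 e1 e2. p > K \<Longrightarrow> zgroup p Z1 \<Longrightarrow> zgroup p Z2 \<Longrightarrow>
      range e1 \<subseteq> carrier (cone Z1) \<Longrightarrow> range e2 \<subseteq> carrier (cone Z2) \<Longrightarrow> eqv Z1 Z2 C M k e1 e2 \<Longrightarrow>
      sat (cone Z1) e1 \<phi> \<longleftrightarrow> sat (cone Z2) e2 \<phi>"
  shows "invariant TYPE('g) \<phi> k C M K"
  unfolding invariant_def using assms by blast

lemma invariant_pos: "invariant TYPE('g::linordered_idom) \<phi> k C M K \<Longrightarrow> M > 0"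
  by (simp add: invariant_def)

lemma invariantD:
  fixes Z1 Z2 :: "'g::linordered_idom set"
  assumes "invariant TYPE('g) \<phi> k C M K" "p > K" "zgroup p Z1" "zgroup p Z2"
    "range e1 \<subseteq> carrier (cone Z1)" "range e2 \<subseteq> carrier (cone Z2)" "eqv Z1 Z2 C M k e1 e2"
  shows "sat (cone Z1) e1 \<phi> \<longleftrightarrow> sat (cone Z2) e2 \<phi>"
  using assms unfolding invariant_def by blast

text \<open>Equality says that neither difference of the two sides is positive. For a quantifier,
  \<open>back_and_forth\<close> finds a matching element at the cost of a larger \<open>C\<close>
  and \<open>M\<close>, and raising \<open>K\<close> to at least \<open>fact C * M\<close> keeps
  \<open>p\<close> from dividing the modulus.\<close>

lemma ex_invariant:
  "fv \<phi> \<subseteq> {..<k} \<Longrightarrow> \<exists>C M K. invariant TYPE('g::linordered_idom) \<phi> k C M K"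
proof (induction \<phi> arbitrary: k)
  case Falsum
  have "invariant TYPE('g) Falsum k 1 1 0" by (simp add: invariant_def)
  then show ?case by blast
next
  case (Eq s t)
  obtain C D where CD: "\<And>i. \<bar>occ s i\<bar> \<le> int C" "\<And>i. \<bar>occ t i\<bar> \<le> int D"
    using occ_bound by metis
  have bd: "\<bar>occ s i - occ t i\<bar> \<le> int (C + D)" "\<bar>occ t i - occ s i\<bar> \<le> int (C + D)" for i
    using CD(1)[of i] CD(2)[of i] by auto
  have "invariant TYPE('g) (Eq s t) k (C + D) 1 0"
  proof (rule invariantI)
    fix Z1 Z2 :: "'g set" and e1 e2 assume eqv: "eqv Z1 Z2 (C + D) 1 k e1 e2"
    show "sat (cone Z1) e1 (Eq s t) \<longleftrightarrow> sat (cone Z2) e2 (Eq s t)"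
      using eqv_signD[OF eqv, of "\<lambda>i. occ s i - occ t i" 0] eqv_signD[OF eqv, of "\<lambda>i. occ t i - occ s i" 0] bd Eq
      by (auto simp: eval_cone lin_diff)
  qed simp
  then show ?case by blast
next
  case (Imp \<phi> \<psi>)
  then obtain C1 M1 K1 C2 M2 K2 where i: "invariant TYPE('g) \<phi> k C1 M1 K1" "invariant TYPE('g) \<psi> k C2 M2 K2"
    by fastforce
  have "invariant TYPE('g) (Imp \<phi> \<psi>) k (max C1 C2) (M1 * M2) (max K1 K2)"
  proof (rule invariantI)
    show "M1 * M2 > 0" using invariant_pos[OF i(1)] invariant_pos[OF i(2)] by simp
    fix p and Z1 Z2 :: "'g set" and e1 e2
    assume p: "p > max K1 K2" and Z: "zgroup p Z1" "zgroup p Z2" and e: "range e1 \<subseteq> carrier (cone Z1)"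
      "range e2 \<subseteq> carrier (cone Z2)" and eqv: "eqv Z1 Z2 (max C1 C2) (M1 * M2) k e1 e2"
    have "eqv Z1 Z2 C1 M1 k e1 e2" "eqv Z1 Z2 C2 M2 k e1 e2"
      using eqv_mono[OF eqv _ _ Z, of C1 M1] eqv_mono[OF eqv _ _ Z, of C2 M2] by auto
    then show "sat (cone Z1) e1 (Imp \<phi> \<psi>) \<longleftrightarrow> sat (cone Z2) e2 (Imp \<phi> \<psi>)"
      using invariantD[OF i(1) _ Z e] invariantD[OF i(2) _ Z e] p by simp
  qed
  then show ?case by blast
next
  case (All \<phi>)
  have "fv \<phi> \<subseteq> {..<Suc k}"
  proof
    fix n assume "n \<in> fv \<phi>"
    then show "n \<in> {..<Suc k}" using All.prems by (cases n) auto
  qed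
  then obtain C M K where i: "invariant TYPE('g) \<phi> (Suc k) C M K" using All.IH by blast
  have M: "M > 0" using invariant_pos[OF i] .
  let ?C = "2 * fact C * (C + M)" and ?M = "fact C * M"
  have step: "sat (cone Z2) e2 (All \<phi>)"
    if p: "p > max K ?M" and Z: "zgroup p Z1" "zgroup p Z2" and e: "range e1 \<subseteq> carrier (cone Z1)"
      "range e2 \<subseteq> carrier (cone Z2)" and eqv: "eqv Z1 Z2 ?C ?M k e1 e2" and
      s: "sat (cone Z1) e1 (All \<phi>)"
    for p and Z1 Z2 :: "'g set" and e1 e2
  proof -
    have ndvd: "\<not> p dvd ?M" using p M by (intro nat_dvd_not_less) auto
    then have "\<not> p dvd M" using dvd_mult by blast
    have "sat (cone Z2) (y ## e2) \<phi>" if y: "y \<in> carrier (cone Z2)" for y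
    proof -
      have "\<exists>x\<in>Z1. 0 \<le> x \<and> eqv Z2 Z1 C M (Suc k) (y ## e2) (x ## e1)"
        using y e by (intro back_and_forth[OF Z(2,1) M ndvd \<open>\<not> p dvd M\<close> eqv_sym[OF eqv]]) auto
      then obtain x where x: "x \<in> Z1" "0 \<le> x" "eqv Z2 Z1 C M (Suc k) (y ## e2) (x ## e1)"
        by blast
      then have "x \<in> carrier (cone Z1)" by simp
      then show ?thesis
        using invariantD[OF i _ Z range_scons[OF _ e(1)] range_scons[OF y e(2)] eqv_sym[OF x(3)]] p s
        by simp
    qed
    then show ?thesis by simp
  qed
  have "invariant TYPE('g) (All \<phi>) k ?C ?M (max K ?M)"
  proof (rule invariantI)
    show "?M > 0" using M by simp
    fix p and Z1 Z2 :: "'g set" and e1 e2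
    assume p: "p > max K ?M" and Z: "zgroup p Z1" "zgroup p Z2" and e: "range e1 \<subseteq> carrier (cone Z1)"
      "range e2 \<subseteq> carrier (cone Z2)" and eqv: "eqv Z1 Z2 ?C ?M k e1 e2"
    show "sat (cone Z1) e1 (All \<phi>) \<longleftrightarrow> sat (cone Z2) e2 (All \<phi>)"
      using step[OF p Z e eqv] step[OF p Z(2,1) e(2,1) eqv_sym[OF eqv]] by (rule iffI)
  qed
  then show ?case by blast
qed

lemma finite_fv_tm: "finite (fv_tm t)"
  by (induction t) auto

lemma finite_fv: "finite (fv \<phi>)"
proof (induction \<phi>)
  case (All \<phi>)
  have "fv (All \<phi>) = Suc -` fv \<phi>" by auto
  then show ?case using finite_vimageI[OF All, of Suc] by simp
qed (simp_all add: finite_fv_tm)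

lemma fv_bounded: "\<exists>k. fv \<phi> \<subseteq> {..<k}"
  using finite_nat_bounded[OF finite_fv] .

text \<open>All linear forms vanish at the constant zero environment, so the two positions are
  equivalent for every \<open>C\<close> and \<open>M\<close>.\<close>

lemma transfer:
  "\<exists>K. \<forall>p>K. \<forall>(Z1::'g::linordered_idom set) (Z2::'g set). zgroup p Z1 \<longrightarrow> zgroup p Z2 \<longrightarrow>
     (sat (cone Z1) (\<lambda>_. 0) \<phi> \<longleftrightarrow> sat (cone Z2) (\<lambda>_. 0) \<phi>)"
proof -
  obtain k C M K where i: "invariant TYPE('g) \<phi> k C M K" using fv_bounded ex_invariant by metis
  have "sat (cone Z1) (\<lambda>_. 0) \<phi> \<longleftrightarrow> sat (cone Z2) (\<lambda>_. 0) \<phi>"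
    if "p > K" "zgroup p Z1" "zgroup p Z2" for p and Z1 Z2 :: "'g set"
  proof (rule invariantD[OF i that])
    have "0 \<in> Z1" "0 \<in> Z2" using that zgroup_zero by auto
    then show "range (\<lambda>_::nat. 0) \<subseteq> carrier (cone Z1)" "range (\<lambda>_::nat. 0) \<subseteq> carrier (cone Z2)"
      "eqv Z1 Z2 C M k (\<lambda>_. 0) (\<lambda>_. 0)"
      by (auto simp: eqv_def lin_def intro!: exI[of _ 0] bexI[of _ 0])
  qed
  then show ?thesis by blast
qed

section \<open>Definable sets of natural numbers\<close>

definition Neg :: "fm \<Rightarrow> fm" where
  "Neg \<phi> = Imp \<phi> Falsum"

definition Conj :: "fm \<Rightarrow> fm \<Rightarrow> fm" where
  "Conj \<phi> \<psi> = Neg (Imp \<phi> (Neg \<psi>))"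

definition Disj :: "fm \<Rightarrow> fm \<Rightarrow> fm" where
  "Disj \<phi> \<psi> = Imp (Neg \<phi>) \<psi>"

definition Ex :: "fm \<Rightarrow> fm" where
  "Ex \<phi> = Neg (All (Neg \<phi>))"

lemma sat_connectives [simp]:
  "sat M e (Neg \<phi>) \<longleftrightarrow> \<not> sat M e \<phi>"
  "sat M e (Conj \<phi> \<psi>) \<longleftrightarrow> sat M e \<phi> \<and> sat M e \<psi>"
  "sat M e (Disj \<phi> \<psi>) \<longleftrightarrow> sat M e \<phi> \<or> sat M e \<psi>"
  "sat M e (Ex \<phi>) \<longleftrightarrow> (\<exists>a\<in>carrier M. sat M (a ## e) \<phi>)"
  by (auto simp: Neg_def Conj_def Disj_def Ex_def)

lemma fv_connectives [simp]:
  "fv (Neg \<phi>) = fv \<phi>" "fv (Conj \<phi> \<psi>) = fv \<phi> \<union> fv \<psi>" "fv (Disj \<phi> \<psi>) = fv \<phi> \<union> fv \<psi>"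
  "fv (Ex \<phi>) = {n. Suc n \<in> fv \<phi>}"
  by (auto simp: Neg_def Conj_def Disj_def Ex_def)

section \<open>Eventual periodicity and bounded change\<close>

lemma nat_struct_simps [simp]: "carrier nat_struct = UNIV" "add nat_struct = (+)"
  by (simp_all add: nat_struct_def)

lemma zgroup_int: "zgroup p (UNIV :: int set)"
  by (auto simp: zgroup_def intro: exI[of _ 0])

lemma sat_nat_int: "sat (cone (UNIV :: int set)) (\<lambda>n. int (e n)) \<phi> \<longleftrightarrow> sat nat_struct e \<phi>"
proof (rule sat_iso)
  have "bij_betw int UNIV {x. 0 \<le> x}"
    by (auto simp: bij_betw_def inj_on_def image_iff intro: zero_le_imp_eq_int)
  then show "struct_iso int nat_struct (cone UNIV)" by (simp add: struct_iso_def)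
qed (simp_all add: is_struct_def)

definition nat_invariant :: "fm \<Rightarrow> nat \<Rightarrow> nat \<Rightarrow> nat \<Rightarrow> bool" where
  "nat_invariant \<phi> k C M \<longleftrightarrow> M > 0 \<and> (\<forall>e1 e2.
    (\<forall>a c. (\<forall>i<k. \<bar>a i\<bar> \<le> int C) \<longrightarrow> \<bar>c\<bar> \<le> int C \<longrightarrow>
       (0 < lin k a (\<lambda>i. int (e1 i)) + c \<longleftrightarrow> 0 < lin k a (\<lambda>i. int (e2 i)) + c)) \<longrightarrow>
    (\<forall>i. e1 i mod M = e2 i mod M) \<longrightarrow> (sat nat_struct e1 \<phi> \<longleftrightarrow> sat nat_struct e2 \<phi>))"

lemma nat_invariantD:
  assumes "nat_invariant \<phi> k C M" "\<And>i. e1 i mod M = e2 i mod M"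
    "\<And>a c. (\<And>i. i < k \<Longrightarrow> \<bar>a i\<bar> \<le> int C) \<Longrightarrow> \<bar>c\<bar> \<le> int C \<Longrightarrow>
         0 < lin k a (\<lambda>i. int (e1 i)) + c \<longleftrightarrow> 0 < lin k a (\<lambda>i. int (e2 i)) + c"
  shows "sat nat_struct e1 \<phi> \<longleftrightarrow> sat nat_struct e2 \<phi>"
  using assms unfolding nat_invariant_def by blast

text \<open>The bound has the form \<open>Suc (Suc k)\<close> so that two leading variables can be
  split off a linear form by \<open>lin_Suc\<close>.\<close>

lemma ex_nat_invariant: "\<exists>k C M. nat_invariant \<phi> (Suc (Suc k)) C M"
proof -
  obtain k where "fv \<phi> \<subseteq> {..<k}" using fv_bounded by blast
  then have "fv \<phi> \<subseteq> {..<Suc (Suc k)}" by auto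
  then obtain C M K where i: "invariant TYPE(int) \<phi> (Suc (Suc k)) C M K" using ex_invariant by blast
  have "sat nat_struct e1 \<phi> \<longleftrightarrow> sat nat_struct e2 \<phi>"
    if sgn: "\<forall>a c. (\<forall>i<Suc (Suc k). \<bar>a i\<bar> \<le> int C) \<longrightarrow> \<bar>c\<bar> \<le> int C \<longrightarrow>
         (0 < lin (Suc (Suc k)) a (\<lambda>i. int (e1 i)) + c \<longleftrightarrow> 0 < lin (Suc (Suc k)) a (\<lambda>i. int (e2 i)) + c)"
      and res: "\<forall>i. e1 i mod M = e2 i mod M" for e1 e2
  proof -
    have "eqv UNIV UNIV C M (Suc (Suc k)) (\<lambda>i. int (e1 i)) (\<lambda>i. int (e2 i))"
      unfolding eqv_def
    proof (intro conjI HOL.allI HOL.impI)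
      fix i
      have "int v = of_nat M * int (v div M) + of_int (int (v mod M))" for v
        by (simp flip: of_nat_mult of_nat_add)
      from this[of "e1 i"] this[of "e2 i"]
      show "\<exists>r. \<exists>w1\<in>UNIV. \<exists>w2\<in>UNIV. int (e1 i) = of_nat M * w1 + of_int r
          \<and> int (e2 i) = of_nat M * w2 + of_int r"
        using res by (intro exI[of _ "int (e1 i mod M)"] bexI[of _ "int (e1 i div M)"]
            bexI[of _ "int (e2 i div M)"]) simp_all
    qed (use sgn in auto)
    \<comment> \<open>The integers satisfy \<open>zgroup p\<close> for every \<open>p\<close>, so
      \<open>p = Suc K\<close> may be used.\<close>
    then have "sat (cone (UNIV :: int set)) (\<lambda>i. int (e1 i)) \<phi> \<longleftrightarrow> sat (cone UNIV) (\<lambda>i. int (e2 i)) \<phi>"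
      by (intro invariantD[OF i lessI zgroup_int zgroup_int]) auto
    then show ?thesis by (simp only: sat_nat_int)
  qed
  then have "nat_invariant \<phi> (Suc (Suc k)) C M"
    unfolding nat_invariant_def using invariant_pos[OF i] by blast
  then show ?thesis by blast
qed

lemma int_scons: "(\<lambda>i. int ((x ## e) i)) = int x ## (\<lambda>i. int (e i))"
  by (rule ext) (simp split: nat.split)

lemma abs_lin_le:
  assumes "\<And>i. i < k \<Longrightarrow> \<bar>a i\<bar> \<le> int C"
  shows "\<bar>lin k a (\<lambda>i. int (e i))\<bar> \<le> int (\<Sum>i<k. C * e i)"
proof -
  have "\<bar>lin k a (\<lambda>i. int (e i))\<bar> \<le> (\<Sum>i<k. \<bar>a i * int (e i)\<bar>)"
    unfolding lin_def by simp
  also have "\<dots> \<le> (\<Sum>i<k. int C * int (e i))"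
    by (intro sum_mono) (use assms in \<open>auto simp: abs_mult intro: mult_right_mono\<close>)
  finally show ?thesis by simp
qed

text \<open>The period is the modulus of the invariance, which does not depend on \<open>e\<close>;
  only the bound \<open>X\<close> does. Past it, a form with a nonzero coefficient at
  \<open>x\<close> has the sign of that coefficient.\<close>

lemma eventually_periodic:
  "\<exists>M>0. \<forall>e. \<exists>X. \<forall>x\<ge>X. \<forall>y\<ge>X. x mod M = y mod M \<longrightarrow>
     (sat nat_struct (x ## e) \<phi> \<longleftrightarrow> sat nat_struct (y ## e) \<phi>)"
proof -
  obtain k C M where inv: "nat_invariant \<phi> (Suc (Suc k)) C M" using ex_nat_invariant by blast
  have M: "M > 0" using inv by (simp add: nat_invariant_def)
  have "\<exists>X. \<forall>x\<ge>X. \<forall>y\<ge>X. x mod M = y mod M \<longrightarrow>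
       (sat nat_struct (x ## e) \<phi> \<longleftrightarrow> sat nat_struct (y ## e) \<phi>)" for e
  proof (intro exI HOL.allI HOL.impI)
    fix x y
    let ?X = "(\<Sum>i<Suc k. C * e i) + C + 1"
    assume x: "?X \<le> x" and y: "?X \<le> y" and xy: "x mod M = y mod M"
    show "sat nat_struct (x ## e) \<phi> \<longleftrightarrow> sat nat_struct (y ## e) \<phi>"
    proof (rule nat_invariantD[OF inv])
      show "(x ## e) i mod M = (y ## e) i mod M" for i using xy by (simp split: nat.split)
      fix a c assume a: "\<And>i. i < Suc (Suc k) \<Longrightarrow> \<bar>a i\<bar> \<le> int C" and c: "\<bar>c\<bar> \<le> int C"
      let ?L = "lin (Suc k) (\<lambda>i. a (Suc i)) (\<lambda>i. int (e i))"
      have L: "\<bar>?L\<bar> \<le> int (\<Sum>i<Suc k. C * e i)" using a by (intro abs_lin_le) auto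
      have big: "(0 < a 0 * int v + ?L + c) \<longleftrightarrow> 0 < a 0 \<or> a 0 = 0 \<and> 0 < ?L + c" if v: "?X \<le> v" for v
      proof -
        have v': "\<bar>?L\<bar> + \<bar>c\<bar> < int v" using v L c by linarith
        consider "a 0 \<ge> 1" | "a 0 = 0" | "a 0 \<le> -1" by linarith
        then show ?thesis
        proof cases
          case 1
          then have "1 * int v \<le> a 0 * int v" by (intro mult_right_mono) auto
          then show ?thesis using v' 1 by linarith
        next
          case 3
          then have "a 0 * int v \<le> (-1) * int v" by (intro mult_right_mono) auto
          then show ?thesis using v' 3 by linarith
        qed simp
      qed
      show "0 < lin (Suc (Suc k)) a (\<lambda>i. int ((x ## e) i)) + c \<longleftrightarrow>
          0 < lin (Suc (Suc k)) a (\<lambda>i. int ((y ## e) i)) + c"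
        unfolding int_scons lin_Suc using big[OF x] big[OF y] by simp
    qed
  qed
  then show ?thesis using M by blast
qed

text \<open>\<open>d\<close> is mapped injectively into the \<open>2 B + 1\<close> integers of
  absolute value at most \<open>B\<close>.\<close>

lemma card_affine_le:
  fixes a t :: int and B :: nat
  assumes "a \<noteq> 0"
  shows "finite {d :: nat. \<bar>a * int d + t\<bar> \<le> int B} \<and> card {d :: nat. \<bar>a * int d + t\<bar> \<le> int B} \<le> 2 * B + 1"
proof -
  let ?S = "{d :: nat. \<bar>a * int d + t\<bar> \<le> int B}" and ?f = "\<lambda>d :: nat. a * int d + t"
  have inj: "inj_on ?f ?S" using assms by (auto simp: inj_on_def)
  have sub: "?f ` ?S \<subseteq> {- int B..int B}" by auto
  have "finite ?S" using finite_imageD[OF finite_subset[OF sub] inj] by simp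
  moreover have "card ?S \<le> card {- int B..int B}" using card_inj_on_le[OF inj sub] by simp
  ultimately show ?thesis by simp
qed

text \<open>Replacing \<open>x\<close> by \<open>x + m\<close> changes a form in \<open>d\<close>
  and \<open>x\<close> by at most \<open>C m\<close>, so its sign can change only within
  \<open>C m\<close> of zero. If the coefficient of \<open>d\<close> is nonzero, this happens for
  boundedly many \<open>d\<close>, with a count depending on \<open>m\<close> but not on
  \<open>x\<close>. Forms free of \<open>d\<close> keep their sign once
  \<open>x > C\<close>.\<close>

lemma bounded_change:
  "\<exists>M>0. \<forall>m. M dvd m \<longrightarrow> (\<exists>K X. \<forall>x\<ge>X. \<exists>F. finite F \<and> card F \<le> K \<and>
       (\<forall>d. d \<notin> F \<longrightarrow> (sat nat_struct (d ## x ## (\<lambda>_. 0)) \<phi> \<longleftrightarrow> sat nat_struct (d ## (x + m) ## (\<lambda>_. 0)) \<phi>)))"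
proof -
  obtain k C M where inv: "nat_invariant \<phi> (Suc (Suc k)) C M" using ex_nat_invariant by blast
  have M: "M > 0" using inv by (simp add: nat_invariant_def)
  define I where "I = ({- int C..int C} - {0}) \<times> {- int C..int C} \<times> {- int C..int C}"
  have I: "finite I" unfolding I_def by simp
  have bnd: "\<exists>F. finite F \<and> card F \<le> card I * (2 * (C * m) + 1) \<and>
       (\<forall>d. d \<notin> F \<longrightarrow> (sat nat_struct (d ## x ## (\<lambda>_. 0)) \<phi> \<longleftrightarrow> sat nat_struct (d ## (x + m) ## (\<lambda>_. 0)) \<phi>))"
    if m: "M dvd m" and x: "x \<ge> C + 1" for m x
  proof -
    define S where "S = (\<lambda>(a, b, c). {d :: nat. \<bar>a * int d + (b * int x + c)\<bar> \<le> int (C * m)})"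
    have S: "finite (S i) \<and> card (S i) \<le> 2 * (C * m) + 1" if "i \<in> I" for i
    proof -
      obtain a b c where abc: "i = (a, b, c)" by (cases i)
      then have "a \<noteq> 0" using that by (simp add: I_def)
      then show ?thesis unfolding S_def abc prod.case by (rule card_affine_le)
    qed
    have "card (\<Union>i\<in>I. S i) \<le> (\<Sum>i\<in>I. card (S i))" by (rule card_UN_le[OF I])
    also have "\<dots> \<le> (\<Sum>i\<in>I. 2 * (C * m) + 1)" using S by (intro sum_mono) blast
    finally have "card (\<Union>i\<in>I. S i) \<le> card I * (2 * (C * m) + 1)" by simp
    moreover have "finite (\<Union>i\<in>I. S i)" using I S by blast
    moreover have "sat nat_struct (d ## x ## (\<lambda>_. 0)) \<phi> \<longleftrightarrow> sat nat_struct (d ## (x + m) ## (\<lambda>_. 0)) \<phi>"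
      if d: "d \<notin> (\<Union>i\<in>I. S i)" for d
    proof (rule nat_invariantD[OF inv])
      show "(d ## x ## (\<lambda>_. 0)) i mod M = (d ## (x + m) ## (\<lambda>_. 0)) i mod M" for i
        using m by (auto split: nat.split simp: mod_add_right_eq[symmetric])
      fix a c assume a: "\<And>i. i < Suc (Suc k) \<Longrightarrow> \<bar>a i\<bar> \<le> int C" and c: "\<bar>c\<bar> \<le> int C"
      have a01: "\<bar>a 0\<bar> \<le> int C" "\<bar>a (Suc 0)\<bar> \<le> int C" using a by auto
      have "\<bar>a (Suc 0) * int m\<bar> \<le> int C * int m"
        using a01(2) by (simp add: abs_mult mult_right_mono)
      then have small: "\<bar>a (Suc 0) * int m\<bar> \<le> int (C * m)" by simp
      have "0 < a 0 * int d + (a (Suc 0) * int x + c) \<longleftrightarrow> 0 < a 0 * int d + (a (Suc 0) * int (x + m) + c)"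
      proof (cases "a 0 = 0")
        case True
        consider "a (Suc 0) \<ge> 1" | "a (Suc 0) = 0" | "a (Suc 0) \<le> -1" by linarith
        then show ?thesis
        proof cases
          case 1
          have "0 < a (Suc 0) * int v + c" if "C + 1 \<le> v" for v
          proof -
            have "1 * int v \<le> a (Suc 0) * int v" using 1 by (intro mult_right_mono) auto
            then show ?thesis using that c by linarith
          qed
          from this[of x] this[of "x + m"] show ?thesis using x True by simp
        next
          case 3
          have "\<not> 0 < a (Suc 0) * int v + c" if "C + 1 \<le> v" for v
          proof -
            have "a (Suc 0) * int v \<le> (-1) * int v" using 3 by (intro mult_right_mono) auto
            then show ?thesis using that c by linarith
          qed
          from this[of x] this[of "x + m"] show ?thesis using x True by simp
        qed (simp add: True)
      next
        case False
        then have "(a 0, a (Suc 0), c) \<in> I" using a01 c by (auto simp: I_def abs_le_iff)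
        then have "\<bar>a 0 * int d + (a (Suc 0) * int x + c)\<bar> > int (C * m)" using d by (force simp: S_def)
        then show ?thesis using small unfolding of_nat_add distrib_left by linarith
      qed
      moreover have "lin (Suc (Suc k)) a (\<lambda>i. int ((d ## v ## (\<lambda>_. 0)) i)) + c
          = a 0 * int d + (a (Suc 0) * int v + c)" for v
        unfolding int_scons lin_Suc by (simp add: lin_def)
      ultimately show "0 < lin (Suc (Suc k)) a (\<lambda>i. int ((d ## x ## (\<lambda>_. 0)) i)) + c \<longleftrightarrow>
          0 < lin (Suc (Suc k)) a (\<lambda>i. int ((d ## (x + m) ## (\<lambda>_. 0)) i)) + c"
        by presburger
    qed
    ultimately show ?thesis by blast
  qed
  show ?thesis
  proof (rule exI[of _ M], rule conjI[OF M], intro HOL.allI HOL.impI)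
    fix m assume "M dvd m"
    then show "\<exists>K X. \<forall>x\<ge>X. \<exists>F. finite F \<and> card F \<le> K \<and> (\<forall>d. d \<notin> F \<longrightarrow>
        (sat nat_struct (d ## x ## (\<lambda>_. 0)) \<phi> \<longleftrightarrow> sat nat_struct (d ## (x + m) ## (\<lambda>_. 0)) \<phi>))"
      by (intro exI[of _ "C + 1"] exI[of _ "card I * (2 * (C * m) + 1)"] HOL.allI HOL.impI bnd)
  qed
qed

section \<open>Models of Presburger arithmetic\<close>

text \<open>The consequences of Presburger arithmetic used below, with \<open>one\<close> as the
  least nonzero element. The carrier is abstract so that they cover interpreted models as well as
  \<nat> itself.\<close>

locale arith =
  fixes S :: "'c set" and plus :: "'c \<Rightarrow> 'c \<Rightarrow> 'c"  (infixl "\<oplus>" 65) and zero one :: 'c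
  assumes closed: "a \<in> S \<Longrightarrow> b \<in> S \<Longrightarrow> a \<oplus> b \<in> S"
    and assoc: "a \<in> S \<Longrightarrow> b \<in> S \<Longrightarrow> c \<in> S \<Longrightarrow> (a \<oplus> b) \<oplus> c = a \<oplus> (b \<oplus> c)"
    and comm: "a \<in> S \<Longrightarrow> b \<in> S \<Longrightarrow> a \<oplus> b = b \<oplus> a"
    and cancel: "a \<in> S \<Longrightarrow> b \<in> S \<Longrightarrow> c \<in> S \<Longrightarrow> a \<oplus> c = b \<oplus> c \<Longrightarrow> a = b"
    and zero_in: "zero \<in> S" and one_in: "one \<in> S" and one_zero: "one \<noteq> zero"
    and add_zero: "a \<in> S \<Longrightarrow> a \<oplus> zero = a"
    and zero_sum: "a \<in> S \<Longrightarrow> b \<in> S \<Longrightarrow> a \<oplus> b = zero \<Longrightarrow> a = zero"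
    and pred: "a \<in> S \<Longrightarrow> a = zero \<or> (\<exists>b\<in>S. a = b \<oplus> one)"
begin

primrec mult :: "nat \<Rightarrow> 'c \<Rightarrow> 'c" where
  "mult 0 a = zero"
| "mult (Suc n) a = mult n a \<oplus> a"

abbreviation num :: "nat \<Rightarrow> 'c" where
  "num n \<equiv> mult n one"

lemma mult_in: "a \<in> S \<Longrightarrow> mult n a \<in> S"
  by (induction n) (auto simp: zero_in closed)

lemmas carrier_simps = closed zero_in one_in mult_in

lemma left_comm: "a \<in> S \<Longrightarrow> b \<in> S \<Longrightarrow> c \<in> S \<Longrightarrow> a \<oplus> (b \<oplus> c) = b \<oplus> (a \<oplus> c)"
  by (metis assoc comm)

lemmas ac = assoc comm left_comm

lemma zero_add: "a \<in> S \<Longrightarrow> zero \<oplus> a = a"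
  using comm[OF zero_in] by (simp add: add_zero)

lemma mult_add: "a \<in> S \<Longrightarrow> mult (m + n) a = mult m a \<oplus> mult n a"
  by (induction n) (auto simp: add_zero zero_add carrier_simps ac)

lemma left_cancel: "a \<in> S \<Longrightarrow> b \<in> S \<Longrightarrow> c \<in> S \<Longrightarrow> c \<oplus> a = c \<oplus> b \<longleftrightarrow> a = b"
  by (metis cancel comm)

lemma add_eq_self: "a \<in> S \<Longrightarrow> b \<in> S \<Longrightarrow> a \<oplus> b = a \<longleftrightarrow> b = zero"
  using left_cancel[of b zero a] by (simp add: add_zero zero_in)

lemma num_zero: "num n = zero \<longleftrightarrow> n = 0"
proof (cases n)
  case (Suc m)
  have "num m \<oplus> one \<noteq> zero"
    using zero_sum[of one "num m"] one_zero by (auto simp: carrier_simps comm)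
  then show ?thesis using Suc by simp
qed simp

lemma num_inj: "num m = num n \<longleftrightarrow> m = n"
proof -
  have *: "num (m + Suc k) \<noteq> num m" for m k
    unfolding mult_add[OF one_in]
    using add_eq_self[OF mult_in[OF one_in] mult_in[OF one_in], of m "Suc k"] num_zero[of "Suc k"] by simp
  show ?thesis
  proof
    assume eq: "num m = num n"
    show "m = n"
    proof (rule ccontr)
      assume "m \<noteq> n"
      then consider k where "n = m + Suc k" | k where "m = n + Suc k"
        by (metis add_Suc_right less_natE linorder_neqE_nat)
      then show False using * eq by cases metis+
    qed
  qed simp
qed

definition less :: "'c \<Rightarrow> 'c \<Rightarrow> bool" where
  "less a b \<longleftrightarrow> (\<exists>c\<in>S. c \<noteq> zero \<and> b = a \<oplus> c)"

text \<open>The predecessor axiom can be applied any number of times, because reaching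
  \<open>zero\<close> would make \<open>a\<close> a numeral.\<close>

lemma nonstandard_above:
  assumes "a \<in> S" "\<And>n. a \<noteq> num n"
  shows "\<exists>b\<in>S. b \<noteq> zero \<and> a = num n \<oplus> b"
proof (induction n)
  case 0
  then show ?case using assms(1) assms(2)[of 0] by (intro bexI[of _ a]) (auto simp: comm add_zero zero_in)
next
  case (Suc n)
  then obtain b where b: "b \<in> S" "b \<noteq> zero" "a = num n \<oplus> b" by blast
  then obtain c where c: "c \<in> S" "b = c \<oplus> one" using pred by blast
  have "a = num (Suc n) \<oplus> c" using b c by (simp add: carrier_simps ac)
  moreover have "c \<noteq> zero" using calculation assms(2)[of "Suc n"] by (auto simp: carrier_simps add_zero)
  ultimately show ?case using c by blast
qed

lemma less_mult_Suc:
  assumes a: "a \<in> S" and x: "x \<in> S" and "less x (mult i a)"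
  shows "less x (mult (Suc i) a)"
proof -
  obtain c where c: "c \<in> S" "c \<noteq> zero" "mult i a = x \<oplus> c" using assms(3) by (auto simp: less_def)
  then have "mult (Suc i) a = x \<oplus> (c \<oplus> a)" using a x by (simp add: assoc)
  moreover have "c \<oplus> a \<noteq> zero" using zero_sum c a by blast
  ultimately show ?thesis unfolding less_def using closed[OF c(1) a] by blast
qed

text \<open>A nonstandard \<open>a\<close> would put infinitely many elements between \<open>i a\<close> and \<open>(i + 1) a\<close>.\<close>

lemma nonstandard_gap:
  assumes a: "a \<in> S" "\<And>n. a \<noteq> num n"
  shows "less (mult i a \<oplus> num n) (mult (Suc i) a)" "\<not> less (mult i a \<oplus> num n) (mult i a)"
proof -
  obtain b where b: "b \<in> S" "b \<noteq> zero" "a = num n \<oplus> b" using nonstandard_above[OF a] by blast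
  have "mult i a \<oplus> a = mult i a \<oplus> (num n \<oplus> b)" using b(3) by (rule arg_cong)
  also have "\<dots> = mult i a \<oplus> num n \<oplus> b" using a(1) b(1) by (intro assoc[symmetric]) (auto simp: carrier_simps)
  finally have "mult i a \<oplus> a = mult i a \<oplus> num n \<oplus> b" .
  then show "less (mult i a \<oplus> num n) (mult (Suc i) a)" using b by (auto simp: less_def)
  show "\<not> less (mult i a \<oplus> num n) (mult i a)"
  proof
    assume "less (mult i a \<oplus> num n) (mult i a)"
    then obtain c where c: "c \<in> S" "c \<noteq> zero" "mult i a = mult i a \<oplus> num n \<oplus> c"
      unfolding less_def by blast
    then have "mult i a \<oplus> (c \<oplus> num n) = mult i a" using a by (simp add: ac carrier_simps)
    then have "c \<oplus> num n = zero" using a c add_eq_self by (simp add: carrier_simps)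
    then show False using c zero_sum carrier_simps by blast
  qed
qed

end

lemma PrA_sat:
  assumes "is_model A PrA" "sentence \<phi>" "\<And>e. sat nat_struct e \<phi>" "range e \<subseteq> carrier A"
  shows "sat A e \<phi>"
  using assms by (auto simp: is_model_def PrA_def)

lemma PrA_arith:
  assumes A: "is_model A PrA"
  obtains zero one where "arith (carrier A) (add A) zero one"
proof -
  have str: "is_struct A" using A by (simp add: is_model_def)
  then obtain a0 where a0: "a0 \<in> carrier A" by (auto simp: is_struct_def)
  have e: "range (\<lambda>_::nat. a0) \<subseteq> carrier A" using a0 by auto
  have "sat A (\<lambda>_. a0) (All (All (Eq (Add (Var 0) (Var 1)) (Add (Var 1) (Var 0)))))"
    by (rule PrA_sat[OF A _ _ e]) (auto simp: sentence_def)
  then have comm: "add A a b = add A b a" if "a \<in> carrier A" "b \<in> carrier A" for a b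
    using that by simp
  have "sat A (\<lambda>_. a0) (All (All (All (Eq (Add (Add (Var 0) (Var 1)) (Var 2)) (Add (Var 0) (Add (Var 1) (Var 2)))))))"
    by (rule PrA_sat[OF A _ _ e]) (auto simp: sentence_def)
  then have assoc: "add A (add A a b) c = add A a (add A b c)"
    if "a \<in> carrier A" "b \<in> carrier A" "c \<in> carrier A" for a b c
    using that by simp
  have "sat A (\<lambda>_. a0) (All (All (All (Imp (Eq (Add (Var 0) (Var 2)) (Add (Var 1) (Var 2))) (Eq (Var 0) (Var 1))))))"
    by (rule PrA_sat[OF A _ _ e]) (auto simp: sentence_def)
  then have cancel: "add A a c = add A b c \<Longrightarrow> a = b"
    if "a \<in> carrier A" "b \<in> carrier A" "c \<in> carrier A" for a b c
    using that by simp
  \<comment> \<open>The signature has no constants, so one sentence asserts the existence of zero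
    and one together with all axioms that mention them. Directly below the two quantifiers, index 1
    is zero and index 0 is one.\<close>
  have "sat A (\<lambda>_. a0) (Ex (Ex (Conj (Neg (Eq (Var 0) (Var 1))) (Conj
      (All (Conj (Eq (Add (Var 0) (Var 2)) (Var 0)) (Disj (Eq (Var 0) (Var 2)) (Ex (Eq (Var 1) (Add (Var 0) (Var 2)))))))
      (All (All (Imp (Eq (Add (Var 0) (Var 1)) (Var 3)) (Eq (Var 0) (Var 3)))))))))"
    (is "sat A _ ?\<phi>")
  proof (rule PrA_sat[OF A _ _ e])
    have "\<exists>b. a = Suc b" if "0 < a" for a using that by (cases a) auto
    then show "sat nat_struct e ?\<phi>" for e
      by simp (rule exI[of _ "Suc 0"], auto)
  qed (auto simp: sentence_def)
  then have "\<exists>z\<in>carrier A. \<exists>u\<in>carrier A. u \<noteq> z \<and>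
      (\<forall>a\<in>carrier A. add A a z = a \<and> (a = z \<or> (\<exists>b\<in>carrier A. a = add A b u))) \<and>
      (\<forall>b\<in>carrier A. \<forall>a\<in>carrier A. add A a b = z \<longrightarrow> a = z)"
    by simp
  then obtain z u where zu: "z \<in> carrier A" "u \<in> carrier A" "u \<noteq> z"
    "\<forall>a\<in>carrier A. add A a z = a \<and> (a = z \<or> (\<exists>b\<in>carrier A. a = add A b u))"
    "\<forall>b\<in>carrier A. \<forall>a\<in>carrier A. add A a b = z \<longrightarrow> a = z"
    by (elim bexE conjE) (rule that)
  have "arith (carrier A) (add A) z u"
  proof
    show "a \<in> carrier A \<Longrightarrow> b \<in> carrier A \<Longrightarrow> add A a b \<in> carrier A" for a b
      using str by (simp add: is_struct_def)
  qed (use comm assoc cancel zu in blast)+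
  then show ?thesis by (rule that)
qed

section \<open>Interpretations in the natural numbers\<close>

text \<open>The constant substitution matches the constant environment of
  \<open>int_dom\<close>.\<close>

definition Dom_at :: "translation \<Rightarrow> tm \<Rightarrow> fm" where
  "Dom_at \<iota> t = subst (\<lambda>_. t) (Dom_fm \<iota>)"

definition Add_at :: "translation \<Rightarrow> tm \<Rightarrow> tm \<Rightarrow> tm \<Rightarrow> fm" where
  "Add_at \<iota> t0 t1 t2 = subst (t0 ## t1 ## (\<lambda>_. t2)) (Add_fm \<iota>)"

definition holds_dom :: "translation \<Rightarrow> 'b struct \<Rightarrow> 'b \<Rightarrow> bool" where
  "holds_dom \<iota> M b \<longleftrightarrow> sat M (\<lambda>_. b) (Dom_fm \<iota>)"

definition holds_add :: "translation \<Rightarrow> 'b struct \<Rightarrow> 'b \<Rightarrow> 'b \<Rightarrow> 'b \<Rightarrow> bool" where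
  "holds_add \<iota> M b0 b1 b2 \<longleftrightarrow> sat M (b0 ## b1 ## (\<lambda>_. b2)) (Add_fm \<iota>)"

lemma sat_Dom_at_iff: "sat M e (Dom_at \<iota> t) \<longleftrightarrow> holds_dom \<iota> M (eval M e t)"
  by (simp add: Dom_at_def sat_subst holds_dom_def)

lemma sat_Add_at_iff:
  "sat M e (Add_at \<iota> t0 t1 t2) \<longleftrightarrow> holds_add \<iota> M (eval M e t0) (eval M e t1) (eval M e t2)"
proof -
  have "(\<lambda>n. eval M e ((t0 ## t1 ## (\<lambda>_. t2)) n)) = eval M e t0 ## eval M e t1 ## (\<lambda>_. eval M e t2)"
    by (rule ext) (simp split: nat.split)
  then show ?thesis by (simp add: Add_at_def sat_subst holds_add_def)
qed

lemma int_dom_iff: "b \<in> int_dom \<iota> M \<longleftrightarrow> b \<in> carrier M \<and> holds_dom \<iota> M b"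
  by (simp add: int_dom_def holds_dom_def)

lemma interp_map_add:
  "interp_map \<iota> M A H \<Longrightarrow> b0 \<in> int_dom \<iota> M \<Longrightarrow> b1 \<in> int_dom \<iota> M \<Longrightarrow> b2 \<in> int_dom \<iota> M \<Longrightarrow>
    holds_add \<iota> M b0 b1 b2 \<longleftrightarrow> H b0 = add A (H b1) (H b2)"
  by (simp add: interp_map_def holds_add_def)

lemma sat_Add_at:
  assumes "interp_map \<iota> M A H"
    and "eval M e t0 \<in> int_dom \<iota> M" "eval M e t1 \<in> int_dom \<iota> M" "eval M e t2 \<in> int_dom \<iota> M"
  shows "sat M e (Add_at \<iota> t0 t1 t2) \<longleftrightarrow> H (eval M e t0) = add A (H (eval M e t1)) (H (eval M e t2))"
  using assms by (simp add: sat_Add_at_iff interp_map_add)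

lemma is_struct_nat: "is_struct nat_struct"
  by (simp add: is_struct_def)

lemma sat_nat_Dom_at: "sat nat_struct e (Dom_at \<iota> t) \<longleftrightarrow> eval nat_struct e t \<in> int_dom \<iota> nat_struct"
  by (simp add: sat_Dom_at_iff int_dom_iff)

text \<open>The strict order of the interpreted structure, with the smaller element at index 0 and
  the larger at index 1. A difference \<open>s\<close> is nonzero if
  \<open>s + s \<noteq> s\<close>.\<close>

definition Less_fm :: "translation \<Rightarrow> fm" where
  "Less_fm \<iota> = Ex (Conj (Dom_at \<iota> (Var 0)) (Conj (Neg (Add_at \<iota> (Var 0) (Var 0) (Var 0)))
     (Add_at \<iota> (Var 2) (Var 1) (Var 0))))"

context arith
begin

lemma sat_Less_fm:
  fixes A :: "'c struct"
  assumes A: "carrier A = S" "add A = plus" and H: "interp_map \<iota> nat_struct A H"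
    and d: "d \<in> int_dom \<iota> nat_struct" "d' \<in> int_dom \<iota> nat_struct"
  shows "sat nat_struct (d ## d' ## e) (Less_fm \<iota>) \<longleftrightarrow> less (H d) (H d')"
proof -
  let ?D = "int_dom \<iota> nat_struct"
  have HD: "H ` ?D = S" using H A by (simp add: interp_map_def)
  have "sat nat_struct (d ## d' ## e) (Less_fm \<iota>) \<longleftrightarrow> (\<exists>s\<in>?D. H s \<noteq> H s \<oplus> H s \<and> H d' = H d \<oplus> H s)"
    using d by (auto simp: Less_fm_def sat_nat_Dom_at sat_Add_at[OF H] A)
  also have "\<dots> \<longleftrightarrow> (\<exists>c\<in>S. c \<noteq> c \<oplus> c \<and> H d' = H d \<oplus> c)"
    unfolding HD[symmetric] by blast
  also have "\<dots> \<longleftrightarrow> less (H d) (H d')"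
    unfolding less_def using add_eq_self by metis
  finally show ?thesis .
qed

text \<open>The cuts below \<open>i a\<close> are eventually periodic with a common period \<open>M\<close>, so the sets of residues
  modulo \<open>M\<close> that they eventually contain form an increasing chain of subsets of a finite set.\<close>

lemma interpreted_standard:
  fixes A :: "'c struct"
  assumes A: "carrier A = S" "add A = plus" and H: "interp_map \<iota> nat_struct A H" and a: "a \<in> S"
  shows "\<exists>n. a = num n"
proof (rule ccontr)
  assume "\<nexists>n. a = num n"
  then have ns: "\<And>n. a \<noteq> num n" by blast
  let ?D = "int_dom \<iota> nat_struct"
  have HD: "H ` ?D = S" using H A by (simp add: interp_map_def)
  define I where "I i = {d \<in> ?D. less (H d) (mult i a)}" for i
  let ?\<phi> = "Conj (Dom_at \<iota> (Var 0)) (Less_fm \<iota>)"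
  obtain M where M: "M > 0" and per: "\<forall>e. \<exists>X. \<forall>x\<ge>X. \<forall>y\<ge>X. x mod M = y mod M \<longrightarrow>
       (sat nat_struct (x ## e) ?\<phi> \<longleftrightarrow> sat nat_struct (y ## e) ?\<phi>)"
    using eventually_periodic[of ?\<phi>] by (elim exE conjE) (rule that)
  have perI: "\<exists>X. \<forall>x\<ge>X. \<forall>y\<ge>X. x mod M = y mod M \<longrightarrow> (x \<in> I i \<longleftrightarrow> y \<in> I i)" for i
  proof -
    have "mult i a \<in> H ` ?D" unfolding HD using a by (rule mult_in)
    then obtain b where b: "b \<in> ?D" "H b = mult i a" by (metis imageE)
    have "x \<in> I i \<longleftrightarrow> sat nat_struct (x ## b ## (\<lambda>_. 0)) ?\<phi>" for x
      using b sat_Less_fm[OF A H _ b(1)] by (auto simp: I_def sat_nat_Dom_at)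
    then show ?thesis using per[rule_format, of "b ## (\<lambda>_. 0)"] by simp
  qed
  define R where "R i = {r. r < M \<and> (\<exists>X. \<forall>d\<ge>X. d mod M = r \<longrightarrow> d \<in> I i)}" for i
  have Rsub: "R i \<subseteq> {..<M}" for i by (auto simp: R_def)
  have I_mono: "I i \<subseteq> I (Suc i)" for i
    using less_mult_Suc[OF a] HD by (auto simp: I_def simp del: mult.simps)
  have R_mono: "R i \<subseteq> R (Suc i)" for i
    unfolding R_def using I_mono[of i] by blast
  have "\<exists>i. R i = R (Suc i)"
  proof (rule ccontr)
    assume "\<nexists>i. R i = R (Suc i)"
    then have "R i \<subset> R (Suc i)" for i using R_mono by blast
    then have lt: "card (R i) < card (R (Suc i))" for i
      by (intro psubset_card_mono finite_subset[OF Rsub finite_lessThan])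
    have "i \<le> card (R i)" for i
      by (induction i) (use lt in \<open>auto simp: Suc_le_eq intro: le_less_trans\<close>)
    moreover have "card (R i) \<le> M" for i using card_mono[OF _ Rsub[of i]] by simp
    ultimately show False by (meson not_less_eq_eq order_trans)
  qed
  then obtain i where i: "R i = R (Suc i)" ..
  obtain X where X: "\<forall>x\<ge>X. \<forall>y\<ge>X. x mod M = y mod M \<longrightarrow> (x \<in> I i \<longleftrightarrow> y \<in> I i)" using perI by blast
  obtain Y where Y: "\<forall>x\<ge>Y. \<forall>y\<ge>Y. x mod M = y mod M \<longrightarrow> (x \<in> I (Suc i) \<longleftrightarrow> y \<in> I (Suc i))" using perI by blast
  \<comment> \<open>Beyond \<open>X\<close> and \<open>Y\<close>, membership in each cut depends
    only on the residue. A residue class that meets the larger cut there belongs to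
    \<open>R (Suc i) = R i\<close>, hence lies in the smaller cut.\<close>
  have "I (Suc i) - I i \<subseteq> {..<max X Y}"
  proof (rule ccontr)
    assume "\<not> I (Suc i) - I i \<subseteq> {..<max X Y}"
    then obtain d where d: "d \<in> I (Suc i)" "d \<notin> I i" "d \<ge> X" "d \<ge> Y" by fastforce
    have "\<forall>d'\<ge>Y. d' mod M = d mod M \<longrightarrow> d' \<in> I (Suc i)" using Y d(1,4) by blast
    then have "d mod M \<in> R (Suc i)" unfolding R_def using M by auto
    then have "d mod M \<in> R i" using i by simp
    then have "\<exists>X'. \<forall>d'\<ge>X'. d' mod M = d mod M \<longrightarrow> d' \<in> I i" by (simp add: R_def)
    then obtain X' where X': "\<forall>d'\<ge>X'. d' mod M = d mod M \<longrightarrow> d' \<in> I i" ..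
    have res: "(d + M * X') mod M = d mod M" by simp
    have "d + M * X' \<ge> X'" using M by (simp add: trans_le_add2)
    then have "d + M * X' \<in> I i" using X'[rule_format, OF _ res] by blast
    moreover have "d + M * X' \<ge> X" using d(3) by simp
    ultimately have "d \<in> I i" using X[rule_format, OF _ d(3) res] by blast
    then show False using d(2) by blast
  qed
  then have "finite (H ` (I (Suc i) - I i))" using finite_subset by blast
  \<comment> \<open>A nonstandard \<open>a\<close> places all the elements \<open>i a + n\<close> in
    the difference of the two cuts, although that difference was seen to be finite.\<close>
  moreover have "range (\<lambda>n. mult i a \<oplus> num n) \<subseteq> H ` (I (Suc i) - I i)"
  proof clarify
    fix n
    have "mult i a \<oplus> num n \<in> S" using a by (simp add: carrier_simps)
    then obtain d where d: "d \<in> ?D" "mult i a \<oplus> num n = H d" using HD by (metis imageE)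
    have "d \<in> I (Suc i) - I i"
      using nonstandard_gap[OF a ns, of i n] d by (simp add: I_def del: mult.simps)
    then show "mult i a \<oplus> num n \<in> H ` (I (Suc i) - I i)" using d by blast
  qed
  moreover have "inj (\<lambda>n. mult i a \<oplus> num n)"
    using a by (auto simp: inj_def left_cancel carrier_simps num_inj)
  ultimately show False using finite_subset range_inj_infinite by blast
qed

text \<open>Every element is a unique numeral, so reading off its index turns the interpretation
  into one of \<nat> itself.\<close>

lemma interpreted_nat:
  fixes A :: "'c struct"
  assumes A: "carrier A = S" "add A = plus" and H: "interp_map \<iota> nat_struct A H"
  obtains \<rho> where "interp_map \<iota> nat_struct nat_struct \<rho>"
proof -
  let ?D = "int_dom \<iota> nat_struct"
  have HD: "H ` ?D = S" using H A by (simp add: interp_map_def)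
  have "\<forall>d. \<exists>n. d \<in> ?D \<longrightarrow> H d = num n" using interpreted_standard[OF A H] HD by blast
  then obtain \<rho> where \<rho>: "\<And>d. d \<in> ?D \<Longrightarrow> H d = num (\<rho> d)" by metis
  have "n \<in> \<rho> ` ?D" for n
  proof -
    have "num n \<in> H ` ?D" unfolding HD using mult_in[OF one_in] .
    then obtain d where d: "d \<in> ?D" "num n = H d" by (rule imageE) (rule that)
    then have "n = \<rho> d" using \<rho>[OF d(1)] num_inj by simp
    then show ?thesis using d(1) by (rule image_eqI)
  qed
  moreover have "num a = num b \<oplus> num c \<longleftrightarrow> a = b + c" for a b c
    unfolding mult_add[OF one_in, symmetric] by (rule num_inj)
  ultimately have "interp_map \<iota> nat_struct nat_struct \<rho>"
    using H \<rho> A by (auto simp: interp_map_def)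
  then show ?thesis using that \<rho> by blast
qed

end

lemma PrA_rank:
  assumes A: "is_model A PrA" and H: "interp_map \<iota> nat_struct A H"
  obtains \<rho> where "interp_map \<iota> nat_struct nat_struct \<rho>"
proof -
  obtain z u where "arith (carrier A) (add A) z u" using PrA_arith[OF A] .
  then interpret arith "carrier A" "add A" z u .
  show ?thesis using interpreted_nat[OF refl refl H] that by blast
qed

lemma sat_Less_fm_nat:
  assumes "interp_map \<iota> nat_struct nat_struct \<rho>"
    and "d \<in> int_dom \<iota> nat_struct" "d' \<in> int_dom \<iota> nat_struct"
  shows "sat nat_struct (d ## d' ## e) (Less_fm \<iota>) \<longleftrightarrow> \<rho> d < \<rho> d'"
proof -
  interpret arith "UNIV :: nat set" "(+)" 0 1
  proof
    show "a = 0 \<or> (\<exists>b\<in>UNIV. a = b + 1)" for a :: nat by (cases a) auto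
  qed auto
  have "less a b \<longleftrightarrow> a < b" for a b
    unfolding less_def using less_imp_Suc_add by force
  then show ?thesis using sat_Less_fm[OF _ _ assms] by simp
qed

text \<open>\<open>nmul n t\<close> stands for \<open>(n + 1) t\<close>, since the language has no constant for zero.\<close>

primrec nmul :: "nat \<Rightarrow> tm \<Rightarrow> tm" where
  "nmul 0 t = t"
| "nmul (Suc n) t = Add (nmul n t) t"

lemma eval_nmul_nat: "eval nat_struct e (nmul n t) = Suc n * eval nat_struct e t"
  by (induction n) simp_all

text \<open>The increments of \<open>g\<close> lie between \<open>-K\<close> and \<open>K\<close>,
  and each value is taken on a set that is eventually periodic modulo \<open>W\<close>; hence the
  increment itself is. So \<open>g\<close> eventually gains a constant \<open>a\<close> over every
  stretch of length \<open>W\<close>, and \<open>a > 0\<close> because \<open>g\<close> is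
  unbounded.\<close>

lemma affine_progression:
  fixes g :: "nat \<Rightarrow> nat"
  assumes W: "W > 0" and bd: "\<And>x. g (Suc x) \<le> g x + K" "\<And>x. g x \<le> g (Suc x) + K"
    and up: "\<And>k. k \<le> K \<Longrightarrow> \<exists>X. \<forall>x\<ge>X. \<forall>y\<ge>X. x mod W = y mod W \<longrightarrow> (g (Suc x) = g x + k \<longleftrightarrow> g (Suc y) = g y + k)"
    and down: "\<And>k. k \<le> K \<Longrightarrow> \<exists>X. \<forall>x\<ge>X. \<forall>y\<ge>X. x mod W = y mod W \<longrightarrow> (g x = g (Suc x) + k \<longleftrightarrow> g y = g (Suc y) + k)"
    and unbounded: "\<And>b. \<exists>x. g x > b"
  obtains X a where "a > 0" "\<And>y. g (X + W * y) = g X + a * y"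
proof -
  define \<Delta> where "\<Delta> x = int (g (Suc x)) - int (g x)" for x
  have "\<forall>k. \<exists>X. k \<le> K \<longrightarrow> (\<forall>x\<ge>X. \<forall>y\<ge>X. x mod W = y mod W \<longrightarrow> (g (Suc x) = g x + k \<longleftrightarrow> g (Suc y) = g y + k))"
    using up by blast
  then obtain X1 where X1: "\<And>k x y. k \<le> K \<Longrightarrow> X1 k \<le> x \<Longrightarrow> X1 k \<le> y \<Longrightarrow> x mod W = y mod W \<Longrightarrow>
      (g (Suc x) = g x + k \<longleftrightarrow> g (Suc y) = g y + k)" by metis
  have "\<forall>k. \<exists>X. k \<le> K \<longrightarrow> (\<forall>x\<ge>X. \<forall>y\<ge>X. x mod W = y mod W \<longrightarrow> (g x = g (Suc x) + k \<longleftrightarrow> g y = g (Suc y) + k))"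
    using down by blast
  then obtain X2 where X2: "\<And>k x y. k \<le> K \<Longrightarrow> X2 k \<le> x \<Longrightarrow> X2 k \<le> y \<Longrightarrow> x mod W = y mod W \<Longrightarrow>
      (g x = g (Suc x) + k \<longleftrightarrow> g y = g (Suc y) + k)" by metis
  \<comment> \<open>Only finitely many increments are possible, so one bound dominates all their
    thresholds.\<close>
  define X where "X = (\<Sum>k\<le>K. X1 k + X2 k)"
  have X: "X1 k \<le> X" "X2 k \<le> X" if "k \<le> K" for k
    using member_le_sum[of k "{..K}" "\<lambda>k. X1 k + X2 k"] that unfolding X_def by auto
  have per: "\<Delta> x = \<Delta> y" if xy: "x \<ge> X" "y \<ge> X" "x mod W = y mod W" for x y
  proof (cases "g x \<le> g (Suc x)")
    case True
    then obtain k where k: "g (Suc x) = g x + k" using le_Suc_ex by blast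
    then have "k \<le> K" using bd(1)[of x] by simp
    then have "g (Suc y) = g y + k" using X1[of k x y] X[of k] k xy by simp
    then show ?thesis using k by (simp add: \<Delta>_def)
  next
    case False
    then obtain k where k: "g x = g (Suc x) + k" using le_Suc_ex[of "g (Suc x)" "g x"] by auto
    then have "k \<le> K" using bd(2)[of x] by simp
    then have "g y = g (Suc y) + k" using X2[of k x y] X[of k] k xy by simp
    then show ?thesis using k by (simp add: \<Delta>_def)
  qed
  define a where "a = int (g (X + W)) - int (g X)"
  have shift: "int (g (x + W)) = int (g x) + a" if "x \<ge> X" for x
    using that
  proof (induction x rule: dec_induct)
    case (step n)
    have "\<Delta> (n + W) = \<Delta> n" using step.hyps by (intro per) auto
    then show ?case using step.IH by (simp add: \<Delta>_def)
  qed (simp add: a_def)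
  have lin: "int (g (x + W * y)) = int (g x) + a * int y" if "x \<ge> X" for x y
  proof (induction y)
    case (Suc y)
    have "int (g (x + W * y + W)) = int (g (x + W * y)) + a" using that by (intro shift) simp
    then show ?case using Suc by (simp add: algebra_simps)
  qed simp
  have "a > 0"
  proof (rule ccontr)
    assume "\<not> a > 0"
    define b where "b = Max (g ` {..X + W})"
    have b: "g x \<le> b" if "x \<le> X + W" for x unfolding b_def using that by (intro Max_ge) auto
    obtain x where x: "g x > b" using unbounded by blast
    then have "x > X + W" using b by (meson not_le)
    \<comment> \<open>\<open>x\<close> is moved back by multiples of \<open>W\<close> into the
      window \<open>X..X + W\<close>, where \<open>g\<close> is at most \<open>b\<close>; if
      \<open>a \<le> 0\<close>, this cannot decrease \<open>g\<close>.\<close>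
    then have xx: "x = (X + (x - X) mod W) + W * ((x - X) div W)" by simp
    have "a * int ((x - X) div W) \<le> 0" using \<open>\<not> a > 0\<close> by (simp add: mult_nonpos_nonneg)
    then have "g x \<le> g (X + (x - X) mod W)"
      using lin[of "X + (x - X) mod W" "(x - X) div W"] by (subst xx) linarith
    also have "\<dots> \<le> b" using W by (intro b) (simp add: less_imp_le)
    finally show False using x by simp
  qed
  moreover have "g (X + W * y) = g X + nat a * y" for y
  proof -
    have "int (g (X + W * y)) = int (g X + nat a * y)" using lin[of X y] \<open>a > 0\<close> by simp
    then show ?thesis by (simp only: of_nat_eq_iff)
  qed
  ultimately show ?thesis using that[of "nat a" X] by simp
qed

text \<open>Far out in one residue class modulo \<open>M\<close>, the rank changes boundedly from
  each element to the next, so \<open>affine_progression\<close> applies to the class.\<close>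

lemma linear_rank:
  assumes H: "interp_map \<iota> nat_struct nat_struct \<rho>"
  obtains n c a b where "a > 0" "\<forall>x. Suc n * x + c \<in> int_dom \<iota> nat_struct"
    "\<forall>x. \<rho> (Suc n * x + c) = a * x + b"
proof -
  let ?D = "int_dom \<iota> nat_struct"
  have surj: "\<rho> ` ?D = UNIV" using H by (simp add: interp_map_def)
  obtain M1 where M1: "M1 > 0" and per: "\<forall>e. \<exists>X. \<forall>x\<ge>X. \<forall>y\<ge>X. x mod M1 = y mod M1 \<longrightarrow>
     (sat nat_struct (x ## e) (Dom_at \<iota> (Var 0)) \<longleftrightarrow> sat nat_struct (y ## e) (Dom_at \<iota> (Var 0)))"
    using eventually_periodic[of "Dom_at \<iota> (Var 0)"] by (elim exE conjE) (rule that)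
  obtain M2 where M2: "M2 > 0" and bounded: "\<forall>m. M2 dvd m \<longrightarrow> (\<exists>K X. \<forall>x\<ge>X. \<exists>F. finite F \<and> card F \<le> K \<and>
       (\<forall>d. d \<notin> F \<longrightarrow> (sat nat_struct (d ## x ## (\<lambda>_. 0)) (Less_fm \<iota>) \<longleftrightarrow>
          sat nat_struct (d ## (x + m) ## (\<lambda>_. 0)) (Less_fm \<iota>))))"
    using bounded_change[of "Less_fm \<iota>"] by (elim exE conjE) (rule that)
  \<comment> \<open>\<open>M1\<close> controls membership in the domain and \<open>M2\<close> the
    change of initial segments.\<close>
  define M where "M = M1 * M2"
  have M: "M > 0" using M1 M2 by (simp add: M_def)
  obtain X1 where X1: "\<And>x y. x \<ge> X1 \<Longrightarrow> y \<ge> X1 \<Longrightarrow> x mod M1 = y mod M1 \<Longrightarrow> x \<in> ?D \<longleftrightarrow> y \<in> ?D"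
    using per[rule_format, of "\<lambda>_. 0"] by (auto simp: sat_nat_Dom_at)
  have "M2 dvd M" by (simp add: M_def)
  with bounded obtain K X2 where X2: "\<And>x. x \<ge> X2 \<Longrightarrow> \<exists>F. finite F \<and> card F \<le> K \<and>
       (\<forall>d. d \<notin> F \<longrightarrow> (sat nat_struct (d ## x ## (\<lambda>_. 0)) (Less_fm \<iota>) \<longleftrightarrow>
          sat nat_struct (d ## (x + M) ## (\<lambda>_. 0)) (Less_fm \<iota>)))" by meson
  \<comment> \<open>A rank between those of \<open>x\<close> and \<open>x + M\<close> is represented
    by some \<open>d\<close> lying below exactly one of them, hence by a member of \<open>F\<close>;
    so at most \<open>K\<close> ranks lie between.\<close>
  have jump: "\<rho> (x + M) \<le> \<rho> x + K \<and> \<rho> x \<le> \<rho> (x + M) + K"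
    if x: "x \<ge> X2" "x \<in> ?D" "x + M \<in> ?D" for x
  proof -
    obtain F where F: "finite F" "card F \<le> K" and *: "\<And>d. d \<notin> F \<Longrightarrow> sat nat_struct (d ## x ## (\<lambda>_. 0)) (Less_fm \<iota>) \<longleftrightarrow>
          sat nat_struct (d ## (x + M) ## (\<lambda>_. 0)) (Less_fm \<iota>)" using X2[OF x(1)] by metis
    have eq: "\<rho> d < \<rho> x \<longleftrightarrow> \<rho> d < \<rho> (x + M)" if "d \<in> ?D" "d \<notin> F" for d
      using *[OF that(2)] sat_Less_fm_nat[OF H that(1)] x by simp
    have "v \<le> w + K" if vw: "{w..<v} \<subseteq> \<rho> ` F" for v w
    proof -
      have "card {w..<v} \<le> card F" using vw F by (intro surj_card_le) auto
      then show ?thesis using F by simp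
    qed
    moreover have "{\<rho> x..<\<rho> (x + M)} \<subseteq> \<rho> ` F" "{\<rho> (x + M)..<\<rho> x} \<subseteq> \<rho> ` F"
    proof -
      have "r \<in> \<rho> ` F" if r: "\<rho> x \<le> r \<and> r < \<rho> (x + M) \<or> \<rho> (x + M) \<le> r \<and> r < \<rho> x" for r
      proof -
        have "r \<in> \<rho> ` ?D" using surj by simp
        then obtain d where d: "d \<in> ?D" "r = \<rho> d" by blast
        have "d \<in> F" by (rule ccontr) (use eq[OF d(1)] r d(2) in auto)
        then show ?thesis using d(2) by simp
      qed
      then show "{\<rho> x..<\<rho> (x + M)} \<subseteq> \<rho> ` F" "{\<rho> (x + M)..<\<rho> x} \<subseteq> \<rho> ` F" by auto
    qed
    ultimately show ?thesis by blast
  qed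
  define X where "X = max X1 X2"
  define D where "D r = {d \<in> ?D. d \<ge> X \<and> d mod M = r}" for r
  \<comment> \<open>Ranks are unbounded and there are finitely many residues.\<close>
  have "\<exists>r. \<forall>b. \<exists>d\<in>D r. \<rho> d > b"
  proof (rule ccontr)
    assume "\<nexists>r. \<forall>b. \<exists>d\<in>D r. \<rho> d > b"
    then have "\<forall>r. \<exists>b. \<forall>d\<in>D r. \<rho> d \<le> b" by (meson not_le)
    then obtain f where f: "\<And>r d. d \<in> D r \<Longrightarrow> \<rho> d \<le> f r" by metis
    have "\<rho> d \<in> (\<Union>r<M. {..f r}) \<union> \<rho> ` {..<X}" if "d \<in> ?D" for d
      using f[of d "d mod M"] that M by (cases "d \<ge> X") (auto simp: D_def)
    then have "\<rho> ` ?D \<subseteq> (\<Union>r<M. {..f r}) \<union> \<rho> ` {..<X}" by blast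
    then have "finite (\<rho> ` ?D)" by (rule finite_subset) auto
    then show False using surj by simp
  qed
  then obtain r where r: "\<And>b. \<exists>d\<in>D r. \<rho> d > b" by blast
  \<comment> \<open>With the least element of the class, every other one has the form
    \<open>M x + c\<close>, and all of these lie in the domain by periodicity.\<close>
  define c where "c = (LEAST d. d \<in> D r)"
  have c: "c \<in> D r" "\<And>d. d \<in> D r \<Longrightarrow> c \<le> d"
    using r[of 0] unfolding c_def by (auto intro: LeastI Least_le)
  have inD: "M * x + c \<in> ?D" for x
  proof -
    have "(M * x + c) mod M1 = c mod M1" unfolding M_def by (simp add: mult.assoc)
    then show ?thesis using X1[of "M * x + c" c] c(1) by (auto simp: D_def X_def)
  qed
  define g where "g x = \<rho> (M * x + c)" for x
  have bd: "g (Suc x) \<le> g x + K" "g x \<le> g (Suc x) + K" for x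
  proof -
    have e: "M * x + c + M = M * Suc x + c" by simp
    have "X2 \<le> M * x + c" using c(1) by (simp add: D_def X_def trans_le_add2)
    then show "g (Suc x) \<le> g x + K" "g x \<le> g (Suc x) + K"
      using jump[of "M * x + c", unfolded e] inD[of x] inD[of "Suc x"] unfolding g_def by blast+
  qed
  have unb: "\<exists>x. g x > b" for b
  proof -
    obtain d where d: "d \<in> D r" "\<rho> d > b" using r by blast
    have "d mod M = c mod M" using d(1) c(1) by (simp add: D_def)
    then have "M dvd d - c" using mod_eq_dvd_iff_nat[OF c(2)[OF d(1)]] by blast
    then have "M * ((d - c) div M) + c = d" using c(2)[OF d(1)] by simp
    then show ?thesis using d(2) unfolding g_def by metis
  qed
  \<comment> \<open>These terms denote \<open>M x + c\<close> and \<open>M (x + 1) + c\<close>. The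
    constants \<open>c\<close> and \<open>c + M\<close> enter through the environment, as does a
    representative of the increment.\<close>
  let ?t0 = "Add (nmul (M - 1) (Var 0)) (Var 1)" and ?t1 = "Add (nmul (M - 1) (Var 0)) (Var 2)"
  let ?e = "\<lambda>x k. x ## c ## (c + M) ## (\<lambda>_. k)"
  have ev: "eval nat_struct (?e x k) ?t0 = M * x + c" "eval nat_struct (?e x k) ?t1 = M * Suc x + c" for x k
    using M by (simp_all add: eval_nmul_nat)
  \<comment> \<open>The period does not depend on the parameters, so one \<open>W1\<close> serves
    all increments \<open>k\<close>.\<close>
  obtain W1 where W1: "W1 > 0" and up: "\<forall>e. \<exists>X. \<forall>x\<ge>X. \<forall>y\<ge>X. x mod W1 = y mod W1 \<longrightarrow>
     (sat nat_struct (x ## e) (Add_at \<iota> ?t1 ?t0 (Var 3)) \<longleftrightarrow> sat nat_struct (y ## e) (Add_at \<iota> ?t1 ?t0 (Var 3)))"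
    using eventually_periodic[of "Add_at \<iota> ?t1 ?t0 (Var 3)"] by (elim exE conjE) (rule that)
  obtain W2 where W2: "W2 > 0" and down: "\<forall>e. \<exists>X. \<forall>x\<ge>X. \<forall>y\<ge>X. x mod W2 = y mod W2 \<longrightarrow>
     (sat nat_struct (x ## e) (Add_at \<iota> ?t0 ?t1 (Var 3)) \<longleftrightarrow> sat nat_struct (y ## e) (Add_at \<iota> ?t0 ?t1 (Var 3)))"
    using eventually_periodic[of "Add_at \<iota> ?t0 ?t1 (Var 3)"] by (elim exE conjE) (rule that)
  define W where "W = W1 * W2"
  have W: "W > 0" using W1 W2 by (simp add: W_def)
  have mods: "x mod W = y mod W \<Longrightarrow> x mod W1 = y mod W1 \<and> x mod W2 = y mod W2" for x y
    unfolding W_def by (metis mod_mod_cancel dvd_triv_left dvd_triv_right)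
  have v3: "eval nat_struct (?e x k) (Var 3) = k" for x k by (simp add: numeral_3_eq_3)
  have up': "\<exists>X. \<forall>x\<ge>X. \<forall>y\<ge>X. x mod W = y mod W \<longrightarrow> (g (Suc x) = g x + k \<longleftrightarrow> g (Suc y) = g y + k)" for k
  proof -
    have "k \<in> \<rho> ` ?D" using surj by simp
    then obtain dk where dk: "dk \<in> ?D" "\<rho> dk = k" by blast
    have "sat nat_struct (?e x dk) (Add_at \<iota> ?t1 ?t0 (Var 3)) \<longleftrightarrow> g (Suc x) = g x + k" for x
      using sat_Add_at[OF H, of "?e x dk" ?t1 ?t0 "Var 3"] inD[of x] inD[of "Suc x"] dk
      unfolding ev v3 g_def by simp
    then show ?thesis using up[rule_format, of "c ## (c + M) ## (\<lambda>_. dk)"] mods by metis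
  qed
  have down': "\<exists>X. \<forall>x\<ge>X. \<forall>y\<ge>X. x mod W = y mod W \<longrightarrow> (g x = g (Suc x) + k \<longleftrightarrow> g y = g (Suc y) + k)" for k
  proof -
    have "k \<in> \<rho> ` ?D" using surj by simp
    then obtain dk where dk: "dk \<in> ?D" "\<rho> dk = k" by blast
    have "sat nat_struct (?e x dk) (Add_at \<iota> ?t0 ?t1 (Var 3)) \<longleftrightarrow> g x = g (Suc x) + k" for x
      using sat_Add_at[OF H, of "?e x dk" ?t0 ?t1 "Var 3"] inD[of x] inD[of "Suc x"] dk
      unfolding ev v3 g_def by simp
    then show ?thesis using down[rule_format, of "c ## (c + M) ## (\<lambda>_. dk)"] mods by metis
  qed
  obtain X3 a where a: "a > 0" "\<And>y. g (X3 + W * y) = g X3 + a * y"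
    using affine_progression[OF W bd up' down' unb] by blast
  have "M * (X3 + W * x) + c = Suc (M * W - 1) * x + (M * X3 + c)" for x
    using M W by (simp add: algebra_simps)
  then have e: "Suc (M * W - 1) * x + (M * X3 + c) = M * (X3 + W * x) + c" for x by metis
  show ?thesis
  proof (rule that[OF a(1), of "M * W - 1" "M * X3 + c" "g X3"])
    show "\<forall>x. Suc (M * W - 1) * x + (M * X3 + c) \<in> ?D" unfolding e using inD by blast
    show "\<forall>x. \<rho> (Suc (M * W - 1) * x + (M * X3 + c)) = a * x + g X3"
      unfolding e using a(2) g_def by simp
  qed
qed

section \<open>The sentence to be transferred\<close>

text \<open>The number represented by \<open>d\<close> is the rank of \<open>(n + 1) x + c\<close> minus the rank of \<open>c\<close>, so with
  \<open>c\<close> as in \<open>linear_rank\<close> this relation defines an additive map of \<open>x\<close>.\<close>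

definition Scale_fm :: "nat \<Rightarrow> translation \<Rightarrow> tm \<Rightarrow> tm \<Rightarrow> tm \<Rightarrow> fm" where
  "Scale_fm n \<iota> x d c = Conj (Dom_at \<iota> d) (Add_at \<iota> (Add (nmul n x) c) d c)"

text \<open>Defines the number 1 as the indecomposable nonzero element; \<open>x + x = x\<close>
  stands for \<open>x = 0\<close>.\<close>

definition One_fm :: fm where
  "One_fm = Conj (Neg (Eq (Add (Var 0) (Var 0)) (Var 0)))
     (All (All (Imp (Eq (Add (Var 0) (Var 1)) (Var 2))
        (Disj (Eq (Add (Var 0) (Var 0)) (Var 0)) (Eq (Add (Var 1) (Var 1)) (Var 1))))))"

definition Total_fm :: "nat \<Rightarrow> translation \<Rightarrow> fm" where
  "Total_fm n \<iota> = All (Ex (Scale_fm n \<iota> (Var 1) (Var 0) (Var 3)))"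

definition Additive_fm :: "nat \<Rightarrow> translation \<Rightarrow> fm" where
  "Additive_fm n \<iota> = All (All (All (All (All (Imp (Scale_fm n \<iota> (Var 4) (Var 2) (Var 6))
     (Imp (Scale_fm n \<iota> (Var 3) (Var 1) (Var 6)) (Imp (Scale_fm n \<iota> (Add (Var 4) (Var 3)) (Var 0) (Var 6))
        (Add_at \<iota> (Var 0) (Var 2) (Var 1)))))))))"

text \<open>From the outside in, the variables are \<open>d\<close> and then \<open>x\<close>,
  \<open>f\<close>, \<open>v\<close>, \<open>s\<close>, \<open>t\<close>. The image \<open>f\<close>
  of \<open>x\<close> exceeds \<open>d\<close> by \<open>s\<close>, and \<open>t\<close> witnesses
  that \<open>s\<close> is at most the value \<open>v\<close> at the unit.\<close>

definition Cofinal_fm :: "nat \<Rightarrow> translation \<Rightarrow> fm" where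
  "Cofinal_fm n \<iota> = All (Imp (Dom_at \<iota> (Var 0)) (Ex (Ex (Ex (Ex (Ex
     (Conj (Dom_at \<iota> (Var 0)) (Conj (Dom_at \<iota> (Var 1)) (Conj (Scale_fm n \<iota> (Var 4) (Var 3) (Var 7))
     (Conj (Scale_fm n \<iota> (Var 6) (Var 2) (Var 7)) (Conj (Add_at \<iota> (Var 3) (Var 5) (Var 1))
        (Add_at \<iota> (Var 2) (Var 1) (Var 0)))))))))))))"

definition Nontrivial_fm :: "nat \<Rightarrow> translation \<Rightarrow> fm" where
  "Nontrivial_fm n \<iota> = All (Imp (Scale_fm n \<iota> (Var 1) (Var 0) (Var 2)) (Neg (Add_at \<iota> (Var 0) (Var 0) (Var 0))))"

text \<open>The outer quantifier binds the offset \<open>c\<close> and the inner one the unit; the conjuncts say that the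
  relation above is a nontrivial additive map into the interpreted structure with cofinal range and
  gaps bounded by the value at the unit.\<close>

definition Embedding_fm :: "nat \<Rightarrow> translation \<Rightarrow> fm" where
  "Embedding_fm n \<iota> = Ex (Ex (Conj One_fm (Conj (Dom_at \<iota> (Var 1))
     (Conj (All (Dom_at \<iota> (Add (nmul n (Var 0)) (Var 2))))
     (Conj (Total_fm n \<iota>) (Conj (Additive_fm n \<iota>) (Conj (Cofinal_fm n \<iota>) (Nontrivial_fm n \<iota>))))))))"

lemma eval_nmul:
  fixes M :: "'b::comm_semiring_1 struct"
  assumes "add M = (+)"
  shows "eval M e (nmul n t) = of_nat (Suc n) * eval M e t"
  using assms by (induction n) (simp_all add: algebra_simps)

definition scales :: "nat \<Rightarrow> translation \<Rightarrow> 'b::comm_semiring_1 struct \<Rightarrow> 'b \<Rightarrow> 'b \<Rightarrow> 'b \<Rightarrow> bool" where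
  "scales n \<iota> M c x d \<longleftrightarrow> holds_dom \<iota> M d \<and> holds_add \<iota> M (of_nat (Suc n) * x + c) d c"

text \<open>The reading without de Bruijn indices, stated over semirings so as to cover both \<nat>
  and the cone of \<open>Zloc p\<close>.\<close>

lemma sat_Embedding_fm:
  fixes M :: "'b::comm_semiring_1 struct"
  assumes plus: "add M = (+)"
  shows "sat M e (Embedding_fm n \<iota>) \<longleftrightarrow> (\<exists>c\<in>carrier M. \<exists>u\<in>carrier M.
    (u + u \<noteq> u \<and> (\<forall>w\<in>carrier M. \<forall>v\<in>carrier M. v + w = u \<longrightarrow> v + v = v \<or> w + w = w)) \<and>
    holds_dom \<iota> M c \<and> (\<forall>x\<in>carrier M. holds_dom \<iota> M (of_nat (Suc n) * x + c)) \<and>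
    (\<forall>x\<in>carrier M. \<exists>d\<in>carrier M. scales n \<iota> M c x d) \<and>
    (\<forall>x\<in>carrier M. \<forall>y\<in>carrier M. \<forall>d\<in>carrier M. \<forall>d'\<in>carrier M. \<forall>d''\<in>carrier M.
       scales n \<iota> M c x d \<longrightarrow> scales n \<iota> M c y d' \<longrightarrow> scales n \<iota> M c (x + y) d'' \<longrightarrow> holds_add \<iota> M d'' d d') \<and>
    (\<forall>d\<in>carrier M. holds_dom \<iota> M d \<longrightarrow> (\<exists>x\<in>carrier M. \<exists>f\<in>carrier M. \<exists>v\<in>carrier M. \<exists>s\<in>carrier M. \<exists>t\<in>carrier M.
       holds_dom \<iota> M t \<and> holds_dom \<iota> M s \<and> scales n \<iota> M c x f \<and> scales n \<iota> M c u v \<and>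
       holds_add \<iota> M f d s \<and> holds_add \<iota> M v s t)) \<and>
    (\<forall>v\<in>carrier M. scales n \<iota> M c u v \<longrightarrow> \<not> holds_add \<iota> M v v v))"
  unfolding Embedding_fm_def One_fm_def Total_fm_def Additive_fm_def Cofinal_fm_def Nontrivial_fm_def
    Scale_fm_def scales_def
  by (simp only: sat_connectives sat.simps eval.simps sat_Dom_at_iff sat_Add_at_iff plus eval_nmul[OF plus]
      One_nat_def Let_def case_nat_numeral pred_numeral_simps BitM.simps numeral_One nat.case simp_thms)

text \<open>On ranks the relation becomes multiplication by the slope \<open>a\<close>, because the
  rank of the offset cancels.\<close>

lemma nat_Embedding_fm:
  assumes H: "interp_map \<iota> nat_struct nat_struct \<rho>"
  obtains n where "sat nat_struct e (Embedding_fm n \<iota>)"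
proof -
  let ?D = "int_dom \<iota> nat_struct"
  obtain n c a b where a: "a > 0" and "\<forall>x. Suc n * x + c \<in> ?D"
    and "\<forall>x. \<rho> (Suc n * x + c) = a * x + b"
    by (rule linear_rank[OF H]) (rule that)
  then have D: "Suc n * x + c \<in> ?D" and \<rho>: "\<rho> (Suc n * x + c) = a * x + b" for x
    by blast+
  have dom: "holds_dom \<iota> nat_struct d \<longleftrightarrow> d \<in> ?D" for d by (simp add: int_dom_iff)
  have add: "d0 \<in> ?D \<Longrightarrow> d1 \<in> ?D \<Longrightarrow> d2 \<in> ?D \<Longrightarrow> holds_add \<iota> nat_struct d0 d1 d2 \<longleftrightarrow> \<rho> d0 = \<rho> d1 + \<rho> d2"
    for d0 d1 d2 using interp_map_add[OF H] by simp
  have c: "c \<in> ?D" "\<rho> c = b" using D[of 0] \<rho>[of 0] by simp_all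
  have scales: "scales n \<iota> nat_struct c x d \<longleftrightarrow> d \<in> ?D \<and> \<rho> d = a * x" for x d
    using D[of x] \<rho>[of x] c add[of "Suc n * x + c" d c] unfolding scales_def dom of_nat_id by auto
  have surj: "\<exists>d\<in>?D. \<rho> d = r" for r
  proof -
    have "r \<in> \<rho> ` ?D" using H by (simp add: interp_map_def)
    then show ?thesis by blast
  qed
  have cofinal: "\<exists>x f v s t. t \<in> ?D \<and> s \<in> ?D \<and> scales n \<iota> nat_struct c x f \<and> scales n \<iota> nat_struct c 1 v \<and>
      holds_add \<iota> nat_struct f d s \<and> holds_add \<iota> nat_struct v s t" if d: "d \<in> ?D" for d
  proof -
    \<comment> \<open>The first multiple of \<open>a\<close> strictly above \<open>\<rho> d\<close>
      exceeds it by at most \<open>a\<close>, the value at the unit.\<close>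
    define x where "x = \<rho> d div a + 1"
    have x: "\<rho> d \<le> a * x" "a * x \<le> \<rho> d + a"
      unfolding x_def using a by (simp_all add: dividend_less_times_div less_imp_le distrib_left)
    obtain f where f: "f \<in> ?D" "\<rho> f = a * x" using surj by blast
    obtain s where s: "s \<in> ?D" "\<rho> s = a * x - \<rho> d" using surj by blast
    obtain t where t: "t \<in> ?D" "\<rho> t = a - \<rho> s" using surj by blast
    obtain v where v: "v \<in> ?D" "\<rho> v = a" using surj by blast
    have "scales n \<iota> nat_struct c x f" "scales n \<iota> nat_struct c 1 v" "holds_add \<iota> nat_struct f d s"
      "holds_add \<iota> nat_struct v s t"
      using f s t v x d by (simp_all add: scales add)
    then show ?thesis using s(1) t(1) by blast
  qed
  have "sat nat_struct e (Embedding_fm n \<iota>)"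
    unfolding sat_Embedding_fm[OF nat_struct_simps(2)] nat_struct_simps(1)
  proof (rule bexI[OF _ UNIV_I, of _ c], rule bexI[OF _ UNIV_I, of _ 1], intro conjI)
    show "\<forall>x\<in>UNIV. \<exists>d\<in>UNIV. scales n \<iota> nat_struct c x d" unfolding scales using surj by blast
    show "\<forall>d\<in>UNIV. holds_dom \<iota> nat_struct d \<longrightarrow> (\<exists>x\<in>UNIV. \<exists>f\<in>UNIV. \<exists>v\<in>UNIV. \<exists>s\<in>UNIV. \<exists>t\<in>UNIV.
       holds_dom \<iota> nat_struct t \<and> holds_dom \<iota> nat_struct s \<and> scales n \<iota> nat_struct c x f \<and>
       scales n \<iota> nat_struct c 1 v \<and> holds_add \<iota> nat_struct f d s \<and> holds_add \<iota> nat_struct v s t)"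
      unfolding dom using cofinal by (simp add: Bex_def)
  qed (use D c a in \<open>auto simp: scales add dom distrib_left\<close>)
  then show ?thesis by (rule that)
qed

section \<open>The nonstandard structures\<close>

context arith
begin

lemma mult_distrib: "a \<in> S \<Longrightarrow> b \<in> S \<Longrightarrow> mult n (a \<oplus> b) = mult n a \<oplus> mult n b"
  by (induction n) (auto simp: zero_add zero_in carrier_simps ac)

lemma sum_absorb:
  assumes "a \<in> S" "b \<in> S" "v \<in> S" "a = a \<oplus> (v \<oplus> b)"
  shows "v = zero"
  using assms add_eq_self[of a "v \<oplus> b"] zero_sum[of v b] closed by metis

end

lemma eval_nmul_arith:
  assumes "arith (carrier A) (add A) z u" "is_struct A" "range e \<subseteq> carrier A"
  shows "eval A e (nmul n t) = arith.mult (add A) z (Suc n) (eval A e t)"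
proof -
  interpret arith "carrier A" "add A" z u by fact
  show ?thesis using zero_add[OF eval_carrier[OF assms(2,3)]] by (induction n) simp_all
qed

text \<open>In \<nat>, a remainder below \<open>p\<close> is at most \<open>p y\<close> for every
  \<open>y > 0\<close>, which gives a bound without the constant 1. With \<open>v\<close> the image
  of 1, the error is measured on the scale of the map.\<close>

lemma PrA_division:
  assumes A: "is_model A PrA" and ar: "arith (carrier A) (add A) z u"
    and a: "a \<in> carrier A" and v: "v \<in> carrier A" "v \<noteq> z" and p: "p > 0"
  shows "\<exists>q\<in>carrier A. \<exists>r\<in>carrier A. \<exists>w\<in>carrier A. a = add A (arith.mult (add A) z p q) r \<and>
    add A r w = arith.mult (add A) z p v"
proof -
  interpret arith "carrier A" "add A" z u by fact
  have str: "is_struct A" using A by (simp add: is_model_def)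
  obtain p' where p': "p = Suc p'" using p by (cases p) auto
  let ?\<phi> = "All (All (Imp (Neg (Eq (Add (Var 0) (Var 0)) (Var 0))) (Ex (Ex (Ex (Conj
     (Eq (Var 4) (Add (nmul p' (Var 2)) (Var 1))) (Eq (Add (Var 1) (Var 0)) (nmul p' (Var 3)))))))))"
  have fv_nmul: "fv_tm (nmul n t) = fv_tm t" for n t by (induction n) auto
  have "sat nat_struct e ?\<phi>" for e
  proof -
    have "\<exists>q r w. x = p * q + r \<and> r + w = p * y" if "y > 0" for x y :: nat
    proof (intro exI conjI)
      show "x = p * (x div p) + x mod p" by simp
      have "x mod p < p" "p \<le> p * y" using p that by simp_all
      then show "x mod p + (p * y - x mod p) = p * y" by (intro le_add_diff_inverse) linarith
    qed
    then show ?thesis by (simp add: eval_nmul_nat p' del: mult_Suc)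
  qed
  then have "sat A (\<lambda>_. z) ?\<phi>"
    by (intro PrA_sat[OF A]) (auto simp: sentence_def fv_nmul zero_in)
  then have "sat A (v ## a ## (\<lambda>_. z)) (Ex (Ex (Ex (Conj
     (Eq (Var 4) (Add (nmul p' (Var 2)) (Var 1))) (Eq (Add (Var 1) (Var 0)) (nmul p' (Var 3)))))))"
    using a v add_eq_self[of v v] by simp
  then obtain q r w where q: "q \<in> carrier A" "r \<in> carrier A" "w \<in> carrier A"
    and eq: "a = add A (eval A (w ## r ## q ## v ## a ## (\<lambda>_. z)) (nmul p' (Var 2))) r"
    "add A r w = eval A (w ## r ## q ## v ## a ## (\<lambda>_. z)) (nmul p' (Var 3))"
    by simp (elim bexE conjE, rule that)
  have "range (w ## r ## q ## v ## a ## (\<lambda>_. z)) \<subseteq> carrier A"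
    using q a v zero_in by (intro range_scons) auto
  then have "eval A (w ## r ## q ## v ## a ## (\<lambda>_. z)) (nmul p' (Var 2)) = mult p q"
    "eval A (w ## r ## q ## v ## a ## (\<lambda>_. z)) (nmul p' (Var 3)) = mult p v"
    by (simp_all only: eval_nmul_arith[OF ar str] p') simp_all
  then show ?thesis using q eq by metis
qed

section \<open>The group of linear polynomials over a localization\<close>

definition loc :: "nat \<Rightarrow> rat set" where
  "loc p = {q. \<exists>m n. \<not> int p dvd m \<and> of_int m * q = of_int n}"

text \<open>For a prime \<open>p\<close>, \<open>loc p\<close> is the localization of the integers
  at \<open>p\<close>. In the order of polynomials \<open>X\<close> exceeds every constant, so
  \<open>Zloc p\<close> is ordered lexicographically, by the coefficient of \<open>X\<close>
  first.\<close>

definition Zloc :: "nat \<Rightarrow> rat poly set" where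
  "Zloc p = {[:of_int a, q:] | a q. q \<in> loc p}"

lemma loc_diff: "prime p \<Longrightarrow> q \<in> loc p \<Longrightarrow> q' \<in> loc p \<Longrightarrow> q - q' \<in> loc p"
proof -
  assume p: "prime p" and "q \<in> loc p" "q' \<in> loc p"
  then obtain m n m' n' where m: "\<not> int p dvd m" "of_int m * q = of_int n"
    "\<not> int p dvd m'" "of_int m' * q' = of_int n'" by (auto simp: loc_def)
  have "of_int (m * m') * (q - q') = of_int m' * (of_int m * q) - of_int m * (of_int m' * q')"
    by (simp add: algebra_simps)
  also have "\<dots> = of_int (m' * n - m * n')" by (simp add: m)
  finally have "of_int (m * m') * (q - q') = of_int (m' * n - m * n')" .
  moreover have "\<not> int p dvd m * m'" using m p by (simp add: prime_dvd_mult_iff)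
  ultimately show ?thesis unfolding loc_def by blast
qed

lemma loc_divide:
  assumes p: "prime p" and q: "q \<in> loc p" and k: "k > 0" "\<not> p dvd k"
  shows "q / of_nat k \<in> loc p"
proof -
  obtain m n where m: "\<not> int p dvd m" "of_int m * q = of_int n" using q by (auto simp: loc_def)
  have "\<not> int p dvd m * int k" using m(1) k p by (simp add: prime_dvd_mult_iff)
  moreover have "of_int (m * int k) * (q / of_nat k) = of_int n" using m(2) k by simp
  ultimately show ?thesis unfolding loc_def by blast
qed

lemma loc_one: "prime p \<Longrightarrow> 1 \<in> loc p"
  unfolding loc_def by (auto intro!: exI[of _ 1] dest: prime_gt_1_nat)

text \<open>If \<open>q\<close> were \<open>1 / p\<close>, the multiplier \<open>m\<close> would be
  divisible by \<open>p\<close>. Hence \<open>X\<close> differs from \<open>p\<close> times any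
  element of \<open>Zloc p\<close> in the coefficient of \<open>X\<close>.\<close>

lemma loc_not_divisible: "q \<in> loc p \<Longrightarrow> of_nat p * q \<noteq> 1"
proof
  assume "q \<in> loc p" and 1: "of_nat p * q = 1"
  then obtain m n where m: "\<not> int p dvd m" "of_int m * q = of_int n" by (auto simp: loc_def)
  have "(of_int m :: rat) = of_int m * (of_nat p * q)" using 1 by simp
  also have "\<dots> = of_int (int p * n)" using m(2) by (simp add: mult.left_commute)
  finally have "m = int p * n" by (simp only: of_int_eq_iff)
  then show False using m(1) by simp
qed

lemma Zloc_iff: "[:b, q:] \<in> Zloc p \<longleftrightarrow> b \<in> \<int> \<and> q \<in> loc p"
  by (auto simp: Zloc_def Ints_def)

lemma Zloc_cases: "x \<in> Zloc p \<Longrightarrow> (\<And>a q. x = [:of_int a, q:] \<Longrightarrow> q \<in> loc p \<Longrightarrow> thesis) \<Longrightarrow> thesis"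
  by (auto simp: Zloc_def)

lemma linear_poly_pos: "0 < [:b, q:] \<longleftrightarrow> 0 < q \<or> q = 0 \<and> 0 < (b :: rat)"
  by (simp add: less_poly_def pos_poly_pCons)

lemma zgroup_Zloc:
  assumes p: "prime p"
  shows "zgroup p (Zloc p)"
  unfolding zgroup_def
proof (intro conjI ballI HOL.impI HOL.allI)
  have loc0: "0 \<in> loc p" using loc_diff[OF p loc_one[OF p] loc_one[OF p]] by simp
  then show "1 \<in> Zloc p" using Zloc_iff[of 1 0 p] by (simp add: one_pCons)
  show "x - y \<in> Zloc p" if "x \<in> Zloc p" "y \<in> Zloc p" for x y
    using that by (auto elim!: Zloc_cases simp: Zloc_iff loc_diff[OF p])
  show "1 \<le> x" if x: "x \<in> Zloc p" "0 < x" for x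
  proof (rule Zloc_cases[OF x(1)])
    fix a q assume xx: "x = [:of_int a, q:]"
    have "x = 1 \<or> 1 < x"
      using x(2) unfolding xx less_poly_def one_pCons by (auto simp: pos_poly_pCons)
    then show ?thesis by auto
  qed
  show "\<exists>w\<in>Zloc p. \<exists>r. x = of_nat m * w + of_int r" if m: "m > 0" "\<not> p dvd m" and x: "x \<in> Zloc p" for m x
  proof (rule Zloc_cases[OF x])
    fix a q assume xx: "x = [:of_int a, q:]" and q: "q \<in> loc p"
    \<comment> \<open>Only the coefficient of \<open>X\<close> is divided; the constant term becomes
      the remainder.\<close>
    have "[:0, q / of_nat m:] \<in> Zloc p" using loc_divide[OF p q m] by (simp add: Zloc_iff)
    moreover have "x = of_nat m * [:0, q / of_nat m:] + of_int a"
      using m by (simp add: xx of_nat_poly of_int_poly)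
    ultimately show ?thesis by blast
  qed
qed

text \<open>\<open>f X\<close> is divided by \<open>p\<close> with a remainder of at most
  \<open>p (f 1)\<close>, and the quotient is approximated by some \<open>f y\<close> up to
  \<open>f 1\<close>. Then \<open>f X\<close> and \<open>f (p y)\<close> are within
  \<open>p (f 1)\<close> of each other, whereas \<open>X\<close> and \<open>p y\<close> are
  infinitely far apart.\<close>

lemma no_additive_cofinal_map:
  fixes A :: "'c struct" and f :: "rat poly \<Rightarrow> 'c"
  assumes p: "prime p" and A: "is_model A PrA" and ar: "arith (carrier A) (add A) z u"
    and f: "\<And>x. x \<in> carrier (cone (Zloc p)) \<Longrightarrow> f x \<in> carrier A"
    and additive: "\<And>x y. x \<in> carrier (cone (Zloc p)) \<Longrightarrow> y \<in> carrier (cone (Zloc p)) \<Longrightarrow> f (x + y) = add A (f x) (f y)"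
    and cofinal: "\<And>a. a \<in> carrier A \<Longrightarrow> \<exists>x\<in>carrier (cone (Zloc p)). \<exists>s\<in>carrier A. \<exists>t\<in>carrier A.
        f x = add A a s \<and> f 1 = add A s t"
    and nontrivial: "f 1 \<noteq> z"
  shows False
proof -
  let ?B = "carrier (cone (Zloc p))"
  interpret arith "carrier A" "add A" z u by fact
  note Z = zgroup_Zloc[OF p]
  have B_add: "x + y \<in> ?B" if "x \<in> ?B" "y \<in> ?B" for x y using that zgroup_add[OF Z] by auto
  have B_0: "0 \<in> ?B" and B_1: "1 \<in> ?B" using zgroup_zero[OF Z] zgroup_one[OF Z] by auto
  have B_mult: "of_nat n * x \<in> ?B" if "x \<in> ?B" for n x using that zgroup_of_nat_mult[OF Z] by auto
  have f0: "f 0 = z" using additive[OF B_0 B_0] add_eq_self[of "f 0" "f 0"] f[OF B_0] by simp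
  have f_mult: "f (of_nat n * x) = mult n (f x)" if "x \<in> ?B" for n x
  proof (induction n)
    case (Suc n)
    have "f (of_nat n * x + x) = add A (f (of_nat n * x)) (f x)" using that B_mult by (intro additive) auto
    then show ?case using Suc by (simp add: algebra_simps)
  qed (simp add: f0)
  let ?X = "[:0, 1:] :: rat poly"
  have X: "?X \<in> ?B" using loc_one[OF p] linear_poly_pos[of 0 1] by (simp add: Zloc_iff less_imp_le)
  let ?v = "f 1"
  have v: "?v \<in> carrier A" using f[OF B_1] .
  obtain q r w where q: "q \<in> carrier A" "r \<in> carrier A" "w \<in> carrier A"
    "f ?X = add A (mult p q) r" "add A r w = mult p ?v"
    using PrA_division[OF A ar f[OF X] v nontrivial, of p] prime_gt_0_nat[OF p] by blast
  obtain y s t where y: "y \<in> ?B" and s: "s \<in> carrier A" "t \<in> carrier A"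
    "f y = add A q s" "?v = add A s t"
    using cofinal[OF q(1)] by blast
  have py: "of_nat p * y \<in> ?B" using y by (rule B_mult)
  note ms = mult_in[OF s(1), of p] mult_in[OF s(2), of p] mult_in[OF q(1), of p] mult_in[OF v, of p]
  have pv: "mult p ?v = add A (mult p s) (mult p t)" using s by (simp add: mult_distrib)
  have fpy: "f (of_nat p * y) = add A (mult p q) (mult p s)"
    using f_mult[OF y] s q by (simp add: mult_distrib)
  \<comment> \<open>Different coefficients of \<open>X\<close> mean an infinite distance, in
    particular more than \<open>p + 1\<close>. The 1 beyond \<open>p\<close> provides the surplus
    \<open>f 1\<close> for the contradiction.\<close>
  have far: "\<exists>W\<in>?B. x' = x + (of_nat p * 1 + (1 + W))"
    if "x \<in> ?B" "x' \<in> ?B" "x = [:b, c:]" "x' = [:b', c':]" "c < c'" for x x' b b' c c'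
  proof (intro bexI)
    let ?W = "x' - x - (of_nat p * 1 + 1)"
    show "x' = x + (of_nat p * 1 + (1 + ?W))" by simp
    have "?W = [:b' - b - (of_nat p + 1), c' - c:]" using that by (simp add: of_nat_poly one_pCons)
    then have "0 < ?W" using linear_poly_pos[of _ "c' - c"] that(5) by simp
    moreover have "of_nat p * 1 + 1 \<in> ?B" using B_add[OF B_mult[OF B_1] B_1] .
    ultimately show "?W \<in> ?B" using that(1,2) zgroup_diff[OF Z] by auto
  qed
  have f_far: "f (x + (of_nat p * 1 + (1 + W))) = add A (f x) (add A (mult p ?v) (add A ?v (f W)))"
    if "x \<in> ?B" "W \<in> ?B" for x W
  proof -
    have "1 + W \<in> ?B" "of_nat p * 1 \<in> ?B" using B_add[OF B_1 that(2)] B_mult[OF B_1] .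
    then show ?thesis
      using additive[OF that(1) B_add, of "of_nat p * 1" "1 + W"] additive[of "of_nat p * 1" "1 + W"]
        additive[OF B_1 that(2)] f_mult[OF B_1] by simp
  qed
  obtain b c where yc: "y = [:b, c:]" "c \<in> loc p" using y by (auto elim!: Zloc_cases)
  have pyc: "of_nat p * y = [:of_nat p * b, of_nat p * c:]" by (simp add: yc of_nat_poly)
  consider "of_nat p * c < 1" | "1 < of_nat p * c" using loc_not_divisible[OF yc(2)] by linarith
  then show False
  proof cases
    case 1
    then obtain W where W: "W \<in> ?B" "?X = of_nat p * y + (of_nat p * 1 + (1 + W))"
      using far[OF py X pyc refl] by blast
    have "add A (mult p q) r = add A (add A (mult p q) (mult p s)) (add A (mult p ?v) (add A ?v (f W)))"
      using q(4) f_far[OF py W(1)] fpy W(2) by metis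
    \<comment> \<open>Replacing \<open>p v\<close> by \<open>r + w\<close> leaves \<open>r\<close>
      equal to itself plus \<open>v\<close> and more, so \<open>v\<close> would be zero.\<close>
    then have "add A (mult p q) r = add A (mult p q) (add A (mult p s) (add A (add A r w) (add A ?v (f W))))"
      using q(5) ms v f[OF W(1)] by (simp add: assoc carrier_simps)
    then have "r = add A (mult p s) (add A (add A r w) (add A ?v (f W)))"
      using left_cancel ms q(1-3) v f[OF W(1)] by (simp add: carrier_simps)
    also have "\<dots> = add A r (add A ?v (add A (mult p s) (add A w (f W))))"
      using ms q(1-3) v f[OF W(1)] by (simp add: carrier_simps ac)
    finally show False
      using sum_absorb[of r "add A (mult p s) (add A w (f W))" ?v] nontrivial ms q(1-3) v f[OF W(1)]
      by (simp add: carrier_simps)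
  next
    case 2
    then obtain W where W: "W \<in> ?B" "of_nat p * y = ?X + (of_nat p * 1 + (1 + W))"
      using far[OF X py refl pyc] by blast
    have "add A (mult p q) (mult p s) = add A (add A (mult p q) r) (add A (mult p ?v) (add A ?v (f W)))"
      using q(4) f_far[OF X W(1)] fpy W(2) by metis
    \<comment> \<open>Now \<open>p s\<close> plays the role of \<open>r\<close>, and
      \<open>p v\<close> is split as \<open>p s + p t\<close>.\<close>
    then have "add A (mult p q) (mult p s) = add A (mult p q) (add A r (add A (add A (mult p s) (mult p t)) (add A ?v (f W))))"
      using pv ms q(1-3) v f[OF W(1)] by (simp add: assoc carrier_simps)
    then have "mult p s = add A r (add A (add A (mult p s) (mult p t)) (add A ?v (f W)))"
      using left_cancel ms q(1-3) v f[OF W(1)] by (simp add: carrier_simps)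
    also have "\<dots> = add A (mult p s) (add A ?v (add A r (add A (mult p t) (f W))))"
      using ms q(1-3) v f[OF W(1)] by (simp add: carrier_simps ac)
    finally show False
      using sum_absorb[of "mult p s" "add A r (add A (mult p t) (f W))" ?v] nontrivial ms q(1-3) v f[OF W(1)]
      by (simp add: carrier_simps)
  qed
qed

section \<open>Refuting the sentence in the nonstandard structures\<close>

lemma is_struct_cone: "zgroup p Z \<Longrightarrow> is_struct (cone Z)"
  using zgroup_zero zgroup_add by (auto simp: is_struct_def)

text \<open>The relation defined by the sentence yields a map excluded by
  \<open>no_additive_cofinal_map\<close>. It is well defined because cancellation makes
  \<open>H\<close> agree on all values related to the same \<open>x\<close>.\<close>

lemma no_Embedding_fm:
  fixes A :: "'c struct"
  assumes p: "prime p" and A: "is_model A PrA" and H: "interp_map \<iota> (cone (Zloc p)) A H"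
  shows "\<not> sat (cone (Zloc p)) e (Embedding_fm n \<iota>)"
proof
  let ?M = "cone (Zloc p)"
  let ?B = "carrier ?M" and ?D = "int_dom \<iota> ?M"
  note Z = zgroup_Zloc[OF p]
  assume "sat ?M e (Embedding_fm n \<iota>)"
  then obtain c u where c: "c \<in> ?B" "holds_dom \<iota> ?M c" and u: "u \<in> ?B" "u + u \<noteq> u"
      "\<forall>w\<in>?B. \<forall>v\<in>?B. v + w = u \<longrightarrow> v + v = v \<or> w + w = w"
    and prog: "\<forall>x\<in>?B. holds_dom \<iota> ?M (of_nat (Suc n) * x + c)"
    and total: "\<forall>x\<in>?B. \<exists>d\<in>?B. scales n \<iota> ?M c x d"
    and additive: "\<forall>x\<in>?B. \<forall>y\<in>?B. \<forall>d\<in>?B. \<forall>d'\<in>?B. \<forall>d''\<in>?B. scales n \<iota> ?M c x d \<longrightarrow>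
       scales n \<iota> ?M c y d' \<longrightarrow> scales n \<iota> ?M c (x + y) d'' \<longrightarrow> holds_add \<iota> ?M d'' d d'"
    and cofinal: "\<forall>d\<in>?B. holds_dom \<iota> ?M d \<longrightarrow> (\<exists>x\<in>?B. \<exists>f\<in>?B. \<exists>v\<in>?B. \<exists>s\<in>?B. \<exists>t\<in>?B.
       holds_dom \<iota> ?M t \<and> holds_dom \<iota> ?M s \<and> scales n \<iota> ?M c x f \<and> scales n \<iota> ?M c u v \<and>
       holds_add \<iota> ?M f d s \<and> holds_add \<iota> ?M v s t)"
    and nontrivial: "\<forall>v\<in>?B. scales n \<iota> ?M c u v \<longrightarrow> \<not> holds_add \<iota> ?M v v v"
    unfolding sat_Embedding_fm[OF cone_simps(2)] by (elim bexE conjE) (rule that)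
  \<comment> \<open>Indecomposability is applied to \<open>1 + (u - 1)\<close>.\<close>
  have u1: "u = 1"
  proof -
    have "0 < u" using u(1,2) by auto
    then have "u - 1 \<in> ?B" "1 \<in> ?B" using u(1) zgroup_discrete[OF Z] zgroup_diff[OF Z] zgroup_one[OF Z] by auto
    moreover have "1 + (u - 1) = u" by simp
    ultimately have "(1 :: rat poly) + 1 = 1 \<or> u - 1 + (u - 1) = u - 1" using u(3) by blast
    then show ?thesis by simp
  qed
  obtain z o' where ar: "arith (carrier A) (add A) z o'" using PrA_arith[OF A] .
  interpret arith "carrier A" "add A" z o' by fact
  have HD: "H ` ?D = carrier A" using H by (simp add: interp_map_def)
  have HA: "H d \<in> carrier A" if "d \<in> ?D" for d using HD that by blast
  have cD: "c \<in> ?D" using c by (simp only: int_dom_iff)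
  have D: "of_nat (Suc n) * x + c \<in> ?D" if x: "x \<in> ?B" for x
  proof -
    have "of_nat (Suc n) * x + c \<in> ?B"
      using x c(1) zgroup_add[OF Z zgroup_of_nat_mult[OF Z]] by (simp del: of_nat_Suc)
    then show ?thesis using prog x by (simp only: int_dom_iff)
  qed
  have scales_D: "d \<in> ?D" if "scales n \<iota> ?M c x d" "d \<in> ?B" for x d
    using that by (simp only: scales_def int_dom_iff)
  have scales: "H (of_nat (Suc n) * x + c) = add A (H d) (H c)"
    if "scales n \<iota> ?M c x d" "x \<in> ?B" "d \<in> ?B" for x d
    using that(1) interp_map_add[OF H D[OF that(2)] scales_D[OF that(1,3)] cD] by (simp only: scales_def)
  obtain g where g: "\<And>x. x \<in> ?B \<Longrightarrow> g x \<in> ?B \<and> scales n \<iota> ?M c x (g x)"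
    using total by metis
  define f where "f x = H (g x)" for x
  have gD: "g x \<in> ?D" if "x \<in> ?B" for x using g[OF that] scales_D by blast
  have unique: "H d = f x" if "scales n \<iota> ?M c x d" "x \<in> ?B" "d \<in> ?B" for x d
  proof (rule cancel)
    show "add A (H d) (H c) = add A (f x) (H c)"
      using scales[OF that] scales[of x "g x"] g[OF that(2)] that(2) unfolding f_def by metis
  qed (use HA cD gD[OF that(2)] scales_D[OF that(1,3)] in \<open>auto simp: f_def\<close>)
  show False
  proof (rule no_additive_cofinal_map[OF p A ar, of f])
    show "f x \<in> carrier A" if "x \<in> ?B" for x using HA[OF gD[OF that]] by (simp only: f_def)
    show "f (x + y) = add A (f x) (f y)" if xy: "x \<in> ?B" "y \<in> ?B" for x y
    proof -
      have "x + y \<in> ?B" using xy zgroup_add[OF Z] by auto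
      then show ?thesis
        using additive g[of x] g[of y] g[of "x + y"] xy gD[of x] gD[of y] gD[of "x + y"] interp_map_add[OF H]
        unfolding f_def by metis
    qed
    show "\<exists>x\<in>?B. \<exists>s\<in>carrier A. \<exists>t\<in>carrier A. f x = add A a s \<and> f 1 = add A s t" if a: "a \<in> carrier A" for a
    proof -
      have "a \<in> H ` ?D" using a HD by simp
      then obtain d where d: "d \<in> ?D" "a = H d" by (metis imageE)
      then have "d \<in> ?B" "holds_dom \<iota> ?M d" by (simp_all only: int_dom_iff)
      then obtain x b v s t where x: "x \<in> ?B" "b \<in> ?B" "v \<in> ?B" "s \<in> ?B" "t \<in> ?B"
        and dom: "holds_dom \<iota> ?M t" "holds_dom \<iota> ?M s" and sc: "scales n \<iota> ?M c x b" "scales n \<iota> ?M c u v"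
        and ad: "holds_add \<iota> ?M b d s" "holds_add \<iota> ?M v s t"
        using cofinal by meson
      have st: "s \<in> ?D" "t \<in> ?D" using x dom by (simp_all only: int_dom_iff)
      have "H b = add A a s'" if "s' = H s" for s'
        using ad(1) interp_map_add[OF H scales_D[OF sc(1) x(2)] d(1) st(1)] d(2) that by simp
      then have "f x = add A a (H s)" using unique[OF sc(1) x(1,2)] by simp
      moreover have "f 1 = add A (H s) (H t)"
        using ad(2) interp_map_add[OF H scales_D[OF sc(2) x(3)] st] unique[OF sc(2) u(1) x(3)] u1 by simp
      ultimately show ?thesis using x(1) HA st by blast
    qed
    have B1: "1 \<in> ?B" using u(1) u1 by simp
    have "\<not> holds_add \<iota> ?M (g 1) (g 1) (g 1)" using nontrivial g[OF B1] u1 by blast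
    then have "f 1 \<noteq> add A (f 1) (f 1)" using interp_map_add[OF H gD[OF B1] gD[OF B1] gD[OF B1]] by (simp add: f_def)
    then show "f 1 \<noteq> z" using zero_in add_zero by metis
  qed
qed

text \<open>\<open>transfer\<close> compares groups inside a single ring, so \<nat> is represented
  there by the nonnegative integers of the ring.\<close>

lemma sat_cone_of_nat:
  "sat (cone (range (of_int :: int \<Rightarrow> 'g::linordered_idom))) (\<lambda>_. 0) \<phi> \<longleftrightarrow> sat nat_struct (\<lambda>_. 0) \<phi>"
proof -
  have "bij_betw (of_nat :: nat \<Rightarrow> 'g) UNIV {x \<in> range of_int. 0 \<le> x}"
    unfolding bij_betw_def
  proof
    show "range of_nat = {x \<in> range (of_int :: int \<Rightarrow> 'g). 0 \<le> x}"
    proof safe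
      fix i :: int assume "(0 :: 'g) \<le> of_int i"
      then have "of_int i = (of_nat (nat i) :: 'g)" by simp
      then show "(of_int i :: 'g) \<in> range of_nat" by blast
    qed (auto intro: image_eqI[of _ _ "int _"])
  qed (simp add: inj_on_def)
  then have "struct_iso (of_nat :: nat \<Rightarrow> 'g) nat_struct (cone (range of_int))"
    by (simp add: struct_iso_def)
  from sat_iso[OF this is_struct_nat, of "\<lambda>_. 0"] show ?thesis by simp
qed

lemma zgroup_range_of_int: "zgroup p (range (of_int :: int \<Rightarrow> 'g::linordered_idom))"
  unfolding zgroup_def
proof (intro conjI ballI HOL.impI HOL.allI)
  show "(1 :: 'g) \<in> range of_int" by (metis of_int_1 rangeI)
  show "x - y \<in> range of_int" if "x \<in> range of_int" "y \<in> range of_int" for x y :: 'g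
    using that by (auto simp flip: of_int_diff)
  show "1 \<le> x" if "x \<in> range of_int" "0 < x" for x :: 'g using that by auto
  show "\<exists>w\<in>range of_int. \<exists>r. x = of_nat m * w + of_int r" if x: "x \<in> range of_int" for x :: 'g and m
  proof -
    obtain i where "x = of_int i" using x by blast
    then have "x = of_nat m * of_int 0 + of_int i" by simp
    then show ?thesis by blast
  qed
qed

lemma eventually_sat_Zloc:
  assumes "sat nat_struct (\<lambda>_. 0) \<phi>"
  shows "\<exists>K. \<forall>p>K. prime p \<longrightarrow> sat (cone (Zloc p)) (\<lambda>_. 0) \<phi>"
proof -
  obtain K where K: "\<forall>p>K. \<forall>(Z1 :: rat poly set) (Z2 :: rat poly set). zgroup p Z1 \<longrightarrow> zgroup p Z2 \<longrightarrow>
     (sat (cone Z1) (\<lambda>_. 0) \<phi> \<longleftrightarrow> sat (cone Z2) (\<lambda>_. 0) \<phi>)"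
    using transfer[where 'g = "rat poly"] by blast
  have "sat (cone (Zloc p)) (\<lambda>_. 0) \<phi>" if "p > K" "prime p" for p
    using K[rule_format, OF that(1) zgroup_range_of_int zgroup_Zloc[OF that(2)]] assms
    by (simp only: sat_cone_of_nat)
  then show ?thesis by blast
qed

lemma eventually_model_Zloc:
  assumes "finite F" "is_theory F" "\<And>\<phi>. \<phi> \<in> F \<Longrightarrow> sat nat_struct (\<lambda>_. 0) \<phi>"
  shows "\<exists>K. \<forall>p>K. prime p \<longrightarrow> is_model (cone (Zloc p)) F"
proof -
  have "\<forall>\<phi>. \<exists>K. \<phi> \<in> F \<longrightarrow> (\<forall>p>K. prime p \<longrightarrow> sat (cone (Zloc p)) (\<lambda>_. 0) \<phi>)"
    using eventually_sat_Zloc assms(3) by blast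
  then obtain K where K: "\<And>\<phi> p. \<phi> \<in> F \<Longrightarrow> p > K \<phi> \<Longrightarrow> prime p \<Longrightarrow> sat (cone (Zloc p)) (\<lambda>_. 0) \<phi>"
    by metis
  \<comment> \<open>The sum dominates the bound of every axiom; here the finiteness of
    \<open>F\<close> enters.\<close>
  have "is_model (cone (Zloc p)) F" if p: "p > (\<Sum>\<phi>\<in>F. K \<phi>)" "prime p" for p
    unfolding is_model_def
  proof (intro conjI ballI HOL.allI HOL.impI)
    show "is_struct (cone (Zloc p))" using is_struct_cone[OF zgroup_Zloc[OF p(2)]] .
    fix \<phi> and e :: "nat \<Rightarrow> rat poly" assume \<phi>: "\<phi> \<in> F"
    have "K \<phi> \<le> (\<Sum>\<phi>\<in>F. K \<phi>)" using member_le_sum[of \<phi> F K] \<phi> assms(1) by simp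
    then have "sat (cone (Zloc p)) (\<lambda>_. 0) \<phi>" using K[OF \<phi> _ p(2)] p(1) by simp
    then show "sat (cone (Zloc p)) e \<phi>" using sat_sentence assms(2) \<phi> unfolding is_theory_def by blast
  qed
  then show ?thesis by blast
qed

section \<open>Contradiction for a large prime\<close>

theorem theorem12:
  assumes "infinite (UNIV :: 'a set)"
  shows "\<not> (\<exists>T. is_theory T \<and> finitely_axiomatizable T \<and> proves_theory PrA T \<and>
           (\<exists>\<iota>. is_translation \<iota> \<and> interprets_in_theory TYPE('a) \<iota> PrA T))"
proof
  assume "\<exists>T. is_theory T \<and> finitely_axiomatizable T \<and> proves_theory PrA T \<and>
           (\<exists>\<iota>. is_translation \<iota> \<and> interprets_in_theory TYPE('a) \<iota> PrA T)"
  then obtain T \<iota> where T: "is_theory T" "finitely_axiomatizable T" "proves_theory PrA T"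
    and \<iota>: "interprets_in_theory TYPE('a) \<iota> PrA T" by blast
  obtain F where F: "finite F" "is_theory F" "\<And>\<phi>. sentence \<phi> \<Longrightarrow> F \<turnstile> \<phi> \<longleftrightarrow> T \<turnstile> \<phi>"
    using T(2) unfolding finitely_axiomatizable_def by blast
  obtain j :: "nat \<Rightarrow> 'a" where j: "inj j" using infinite_countable_subset[OF assms] by blast
  \<comment> \<open>A model of \<open>T\<close> on another type is moved into \<open>'a\<close> to
    apply the assumption, and the interpretation is pulled back along the isomorphism.\<close>
  have interp: "\<exists>(A :: 'a set struct) H. is_model A PrA \<and> interp_map \<iota> M A H"
    if M: "is_model M T" and inj: "inj_on k (carrier M)" for M :: "'b struct" and k :: "'b \<Rightarrow> 'a"
  proof -
    obtain N :: "'a struct" where N: "struct_iso k M N" using transport_struct[OF inj] .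
    have "interprets_in_struct \<iota> PrA N"
      using \<iota> struct_iso_model[OF N M] unfolding interprets_in_theory_def by blast
    then obtain A :: "'a set struct" and H where "is_model A PrA" "interp_map \<iota> N A H"
      by (rule interprets_in_struct_interp_map)
    then show ?thesis using interp_map_iso[OF N] M unfolding is_model_def by blast
  qed
  have nat_T: "is_model nat_struct T"
  proof (rule model_proves[OF _ T(3)])
    show "is_model nat_struct PrA" by (simp add: is_model_def PrA_def is_struct_nat)
  qed
  have "inj_on j (carrier nat_struct)" using j by simp
  from interp[OF nat_T this] obtain A :: "'a set struct" and H
    where "is_model A PrA" "interp_map \<iota> nat_struct A H" by blast
  then obtain \<rho> where "interp_map \<iota> nat_struct nat_struct \<rho>" by (rule PrA_rank)
  then obtain n where n: "sat nat_struct (\<lambda>_. 0) (Embedding_fm n \<iota>)" by (rule nat_Embedding_fm)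
  have "is_model nat_struct F" using model_axiomatization[OF T(1) F(3,2)] nat_T by blast
  then have "sat nat_struct (\<lambda>_. 0) \<phi>" if "\<phi> \<in> F" for \<phi> using that by (simp add: is_model_def)
  then obtain K1 where K1: "\<forall>p>K1. prime p \<longrightarrow> is_model (cone (Zloc p)) F"
    using eventually_model_Zloc[OF F(1,2)] by blast
  obtain K2 where K2: "\<forall>p>K2. prime p \<longrightarrow> sat (cone (Zloc p)) (\<lambda>_. 0) (Embedding_fm n \<iota>)"
    using eventually_sat_Zloc[OF n] by blast
  \<comment> \<open>Large enough for the axioms in \<open>F\<close> and for the sentence at the same
    time.\<close>
  obtain p where p: "prime p" "p > max K1 K2" using bigger_prime by blast
  then have model: "is_model (cone (Zloc p)) T"
    using K1 model_axiomatization[OF T(1) F(3,2)] by auto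
  \<comment> \<open>An element is determined by two rational coefficients, so the carrier is
    countable and embeds in the infinite type \<open>'a\<close>.\<close>
  have "inj_on (\<lambda>x. j (to_nat (coeff x 0, coeff x 1))) (carrier (cone (Zloc p)))"
  proof (rule inj_onI)
    fix x y
    assume "x \<in> carrier (cone (Zloc p))" "y \<in> carrier (cone (Zloc p))"
      and eq: "j (to_nat (coeff x 0, coeff x 1)) = j (to_nat (coeff y 0, coeff y 1))"
    then have "x \<in> Zloc p" "y \<in> Zloc p" by simp_all
    then obtain a q b r where "x = [:of_int a, q:]" "y = [:of_int b, r:]" by (auto simp: Zloc_def)
    then show "x = y" using injD[OF j eq] by simp
  qed
  from interp[OF model this] obtain A :: "'a set struct" and H
    where "is_model A PrA" "interp_map \<iota> (cone (Zloc p)) A H" by blast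
  then have "\<not> sat (cone (Zloc p)) (\<lambda>_. 0) (Embedding_fm n \<iota>)" by (rule no_Embedding_fm[OF p(1)])
  then show False using K2 p by auto
qed

end
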